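(* Let $f$ be an exponential polynomial of order $q\ge1$ such that $C(\operatorname{co}(W_f))>0$. Then the number $n(r,1/f)$ of zeros of $f$ in $|z|<r$, counted with multiplicity, satisfies $$n(r,1/f)=q\,C(\operatorname{co}(W_f))\frac{r^q}{2\pi}+o\left(r^q\right)\quad (r\to\infty).$$
   Context: An exponential polynomial is an entire function $P_0e^{Q_0}+\cdots+P_ne^{Q_n}$ with polynomials $P_j,Q_j$; the $Q_j$ are taken pairwise different with $Q_j(0)=0$, and the order is $q=\max_j\deg Q_j$. It can be written in the normalized form $f(z)=\sum_{j=0}^m H_j(z)e^{w_jz^q}$, where $w_0=0$, the leading coefficients $w_0,\ldots,w_m\in\mathbb{C}$ are pairwise distinct (so $w_j\ne0$ for $j\ge1$), $H_1,\ldots,H_m\not\equiv0$, possibly $H_0\equiv 0$, and the $H_j$ are exponential polynomials of order $\le q-1$ (ordinary polynomials being exponential polynomials of order $0$). $W_f=\{0,\overline{w}_1,\ldots,\overline{w}_m\}$ if $H_0\not\equiv0$, and $W_f=\{\overline{w}_1,\ldots,\overline{w}_m\}$ if $H_0\equiv0$. $\operatorname{co}(W_f)$ is the convex hull and $C(\operatorname{co}(W_f))$ is its circumference (perimeter); if the hull is a segment this is twice its length, and if it is a point this is $0$. *)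

theory Defs
  imports
    "HOL-Complex_Analysis.Complex_Analysis"
    "HOL-Computational_Algebra.Polynomial"
    "HOL-Library.Landau_Symbols"
begin

text \<open>
  \<open>f = P\<^sub>0 e\<^bsup>Q\<^sub>0\<^esup> + \<dots> + P\<^sub>n e\<^bsup>Q\<^sub>n\<^esup>\<close> with pairwise different \<open>Q\<^sub>j\<close>, \<open>Q\<^sub>j(0) = 0\<close>. The order
  \<open>max deg Q\<^sub>j\<close> only makes sense if superfluous terms \<open>0 \<cdot> e\<^bsup>Q\<^esup>\<close> are excluded; a zero coefficient is
  therefore allowed only in front of \<open>e\<^sup>0\<close>, where it does not affect the maximum. With this
  convention the exponential polynomials of order 0 are the ordinary polynomials, including 0.
\<close>
definition exp_poly_of_order :: "nat \<Rightarrow> (complex \<Rightarrow> complex) \<Rightarrow> bool" where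
  "exp_poly_of_order q f \<longleftrightarrow>
     (\<exists>n (P :: nat \<Rightarrow> complex poly) (Q :: nat \<Rightarrow> complex poly).
        inj_on Q {..n} \<and>
        (\<forall>j\<le>n. poly (Q j) 0 = 0) \<and>
        (\<forall>j\<le>n. P j = 0 \<longrightarrow> Q j = 0) \<and>
        (\<forall>z. f z = (\<Sum>j\<le>n. poly (P j) z * exp (poly (Q j) z))) \<and>
        q = Max ((\<lambda>j. degree (Q j)) ` {..n}))"

definition exp_poly_normal_form ::
  "nat \<Rightarrow> (complex \<Rightarrow> complex) \<Rightarrow> nat \<Rightarrow> (nat \<Rightarrow> complex) \<Rightarrow> (nat \<Rightarrow> complex \<Rightarrow> complex) \<Rightarrow> bool" where
  "exp_poly_normal_form q f m w H \<longleftrightarrow>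
     w 0 = 0 \<and> inj_on w {..m} \<and>
     (\<forall>j\<in>{1..m}. H j \<noteq> (\<lambda>z. 0)) \<and>
     (\<forall>j\<le>m. \<exists>d<q. exp_poly_of_order d (H j)) \<and>
     (\<forall>z. f z = (\<Sum>j\<le>m. H j z * exp (w j * z ^ q)))"

text \<open>The set \<open>W\<^sub>f\<close>, read off from a normal form of \<open>f\<close>.\<close>
definition conj_leading_coeffs ::
  "nat \<Rightarrow> (nat \<Rightarrow> complex) \<Rightarrow> (nat \<Rightarrow> complex \<Rightarrow> complex) \<Rightarrow> complex set" where
  "conj_leading_coeffs m w H =
     (if H 0 = (\<lambda>z. 0) then (\<lambda>j. cnj (w j)) ` {1..m} else {0} \<union> (\<lambda>j. cnj (w j)) ` {1..m})"

text \<open>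
  Circumference of a convex polygon: the sum of the lengths of its edges. A degenerate polygon
  (segment, point, empty set) counts as being traversed twice. The length of a segment is its
  diameter.
\<close>
definition circumference :: "complex set \<Rightarrow> real" where
  "circumference K =
     (if aff_dim K \<le> 1 then 2 * diameter K else (\<Sum>e | e edge_of K. diameter e))"

text \<open>\<open>n(r, 1/f)\<close>, used only for entire \<open>f\<close> not identically zero: then the sum is finite and
  \<^const>\<open>zorder\<close> is the (positive) multiplicity of each zero.\<close>
definition zero_count :: "(complex \<Rightarrow> complex) \<Rightarrow> real \<Rightarrow> nat" where
  "zero_count f r = (\<Sum>z | norm z < r \<and> f z = 0. nat (zorder f z))"

lemma exp_poly_of_order_less_sum:
  fixes P Q :: "nat \<Rightarrow> complex poly"
  assumes "finite J" "inj_on Q J" "\<And>j. j \<in> J \<Longrightarrow> poly (Q j) 0 = 0"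
    "\<And>j. j \<in> J \<Longrightarrow> P j = 0 \<Longrightarrow> Q j = 0" "\<And>j. j \<in> J \<Longrightarrow> degree (Q j) < q" "0 < q"
  shows "\<exists>d<q. exp_poly_of_order d (\<lambda>z. \<Sum>j\<in>J. poly (P j) z * exp (poly (Q j) z))"
proof (cases "J = {}")
  case True
  have "exp_poly_of_order 0 (\<lambda>z. 0)"
    unfolding exp_poly_of_order_def
    by (rule exI[of _ 0], rule exI[of _ "\<lambda>_. 0"], rule exI[of _ "\<lambda>_. 0"]) auto
  then show ?thesis using True assms by auto
next
  case False
  obtain h where "bij_betw h {0..<card J} J"
    using ex_bij_betw_nat_finite[OF assms(1)] by blast
  moreover obtain n where "card J = Suc n"
    using False assms(1) by (metis card_0_eq not0_implies_Suc)
  moreover have "{0..<Suc n} = {..n}" by auto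
  ultimately have h: "bij_betw h {..n} J" by simp
  then have hJ: "h j \<in> J" if "j \<le> n" for j using that by (auto simp: bij_betw_def)
  define d where "d = Max ((\<lambda>j. degree (Q (h j))) ` {..n})"
  have "d < q" unfolding d_def using assms(5) hJ by (subst Max_less_iff) auto
  moreover have "(\<Sum>j\<in>J. poly (P j) z * exp (poly (Q j) z)) =
      (\<Sum>j\<le>n. poly (P (h j)) z * exp (poly (Q (h j)) z))" for z
    using sum.reindex_bij_betw[OF h, of "\<lambda>j. poly (P j) z * exp (poly (Q j) z)"] by simp
  moreover have "inj_on (\<lambda>j. Q (h j)) {..n}"
    using comp_inj_on[of h "{..n}" Q] h assms(2) by (auto simp: bij_betw_def comp_def)
  ultimately have "exp_poly_of_order d (\<lambda>z. \<Sum>j\<in>J. poly (P j) z * exp (poly (Q j) z))"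
    unfolding exp_poly_of_order_def
    by (intro exI[of _ n] exI[of _ "\<lambda>j. P (h j)"] exI[of _ "\<lambda>j. Q (h j)"])
      (simp add: assms(3,4) hJ d_def)
  then show ?thesis using \<open>d < q\<close> by blast
qed

lemma exp_poly_normal_form_exists:
  assumes "exp_poly_of_order q f" "q \<ge> 1"
  shows "\<exists>m w H. exp_poly_normal_form q f m w H"
proof -
  obtain n and P Q :: "nat \<Rightarrow> complex poly" where
    inj: "inj_on Q {..n}" and Q0: "\<And>j. j \<le> n \<Longrightarrow> poly (Q j) 0 = 0"
    and PQ: "\<And>j. j \<le> n \<Longrightarrow> P j = 0 \<Longrightarrow> Q j = 0"
    and f: "\<And>z. f z = (\<Sum>j\<le>n. poly (P j) z * exp (poly (Q j) z))"
    and q: "q = Max ((\<lambda>j. degree (Q j)) ` {..n})"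
    using assms(1) unfolding exp_poly_of_order_def by (elim exE conjE) (rule that, auto)
  have deg: "degree (Q j) \<le> q" if "j \<le> n" for j unfolding q using that by (intro Max_ge) auto
  define J where "J a = {j. j \<le> n \<and> coeff (Q j) q = a}" for a
  define R where "R a j = Q j - monom a q" for a j
  define G where "G a z = (\<Sum>j\<in>J a. poly (P j) z * exp (poly (R a j) z))" for a z
  have G_order: "\<exists>d<q. exp_poly_of_order d (G a)" for a
    unfolding G_def
  proof (rule exp_poly_of_order_less_sum)
    show "finite (J a)" "0 < q" using assms by (auto simp: J_def)
    show "inj_on (R a) (J a)" using inj by (auto simp: inj_on_def J_def R_def)
    fix j assume j: "j \<in> J a"
    show "poly (R a j) 0 = 0" using j Q0 assms(2) by (auto simp: J_def R_def poly_monom)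
    show "R a j = 0" if "P j = 0" using that j PQ[of j] by (auto simp: J_def R_def)
    have "degree (R a j) \<le> q"
      using j deg[of j] unfolding R_def
      by (intro degree_diff_le) (auto simp: J_def intro: order.trans[OF degree_monom_le])
    moreover have "coeff (R a j) q = 0" using j by (auto simp: J_def R_def)
    ultimately show "degree (R a j) < q"
      using assms(2) eq_zero_or_degree_less[of "R a j" q] by auto
  qed
  define A where "A = (\<lambda>j. coeff (Q j) q) ` {..n}"
  define B where "B = {a \<in> A. a \<noteq> 0 \<and> G a \<noteq> (\<lambda>z. 0)}"
  have fA: "finite A" and fB: "finite B" by (auto simp: A_def B_def)
  have "f z = (\<Sum>a\<in>A. G a z * exp (a * z ^ q))" for z
  proof -
    have "f z = (\<Sum>a\<in>A. \<Sum>j | j \<in> {..n} \<and> coeff (Q j) q = a. poly (P j) z * exp (poly (Q j) z))"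
      unfolding f A_def by (subst sum.image_gen[of "{..n}" _ "\<lambda>j. coeff (Q j) q"]) auto
    also have "\<dots> = (\<Sum>a\<in>A. G a z * exp (a * z ^ q))"
      unfolding G_def sum_distrib_right
      by (intro sum.cong)
        (auto simp: J_def R_def poly_monom exp_diff)
    finally show ?thesis .
  qed
  also have "(\<Sum>a\<in>A. G a z * exp (a * z ^ q)) = (\<Sum>a\<in>insert 0 B. G a z * exp (a * z ^ q))" for z
  proof (rule sum.mono_neutral_cong)
    have "G 0 z = 0" if "0 \<notin> A"
    proof -
      have "J 0 = {}" using that by (force simp: J_def A_def)
      then show ?thesis by (simp add: G_def)
    qed
    then show "G i z * exp (i * z ^ q) = 0" if "i \<in> insert 0 B - A" for i
      using that by (auto simp: B_def)
    show "G i z * exp (i * z ^ q) = 0" if "i \<in> A - insert 0 B" for i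
      using that by (auto simp: B_def)
  qed (use fA fB in auto)
  finally have fz: "f z = (\<Sum>a\<in>insert 0 B. G a z * exp (a * z ^ q))" for z .
  obtain h where h: "bij_betw h {1..card B} B"
    using ex_bij_betw_nat_finite_1[OF fB] by blast
  define m where "m = card B"
  define w where "w j = (if j = 0 then 0 else h j)" for j
  have wB: "w j \<in> B" if "j \<in> {1..m}" for j
    using that h by (auto simp: w_def m_def bij_betw_def)
  have bij: "bij_betw w {..m} (insert 0 B)"
  proof -
    have "bij_betw w {1..m} B"
      using h unfolding m_def by (subst bij_betw_cong[of _ _ h]) (auto simp: w_def)
    then have "bij_betw w (insert 0 {1..m}) (insert (w 0) B)"
      using notIn_Un_bij_betw[of 0 "{1..m}" w B] by (auto simp: w_def B_def)
    moreover have "insert 0 {1..m} = {..m}" by auto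
    ultimately show ?thesis by (simp add: w_def)
  qed
  have "exp_poly_normal_form q f m w (\<lambda>j. G (w j))"
    unfolding exp_poly_normal_form_def
  proof (intro conjI allI ballI impI)
    show "w 0 = 0" by (simp add: w_def)
    show "inj_on w {..m}" using bij by (simp add: bij_betw_def)
    show "G (w j) \<noteq> (\<lambda>z. 0)" if "j \<in> {1..m}" for j using wB[OF that] by (simp add: B_def)
    show "\<exists>d<q. exp_poly_of_order d (G (w j))" for j by (rule G_order)
    show "f z = (\<Sum>j\<le>m. G (w j) z * exp (w j * z ^ q))" for z
      unfolding fz using sum.reindex_bij_betw[OF bij, of "\<lambda>a. G a z * exp (a * z ^ q)"] by simp
  qed
  then show ?thesis by blast
qed

end

theory Submission
  imports Defs
begin

text \<open>
  By Jensen's formula it suffices to determine the circular means of \<open>log \<bar>f\<bar>\<close>. They are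
  compared with the indicator \<open>h(z) = max\<^sub>j Re (w\<^sub>j z\<^sup>q)\<close>, whose mean over the unit circle is the
  perimeter of \<open>co(W\<^sub>f)\<close> divided by \<open>2\<pi>\<close> (Cauchy's formula), since \<open>h\<close> is the support function of
  \<open>co(W\<^sub>f)\<close> evaluated at \<open>z\<^sup>q\<close>. Dividing by a finite Blaschke product replaces \<open>log \<bar>f\<bar>\<close> on \<open>\<bar>z\<bar> < R\<close>
  by a harmonic majorant \<open>u\<close> with the same boundary values, so no singular integrals occur. The
  bound \<open>\<bar>f\<bar> \<le> exp (h + o(R\<^sup>q))\<close> gives the upper estimate for \<open>u(0)\<close>. For the lower one,
  \<open>u / R\<^sup>q\<close> is, by Borel-Caratheodory, uniformly Lipschitz on smaller discs in the variable \<open>z / R\<close>,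
  so it is enough to find, near each point of a fine net, one point where \<open>\<bar>f\<bar>\<close> is almost
  \<open>exp h\<close>. Away from the critical rays a single term dominates, and its coefficient, being of order
  less than \<open>q\<close>, cannot be small on a whole disc of radius comparable to \<open>R\<close> by the three circles
  theorem. Finally the asymptotics of the integrated counting function are differentiated using the
  monotonicity of \<open>n(r, 1/f)\<close>.
\<close>

section \<open>Cauchy's formula for the perimeter of a polygon\<close>

definition support :: "complex set \<Rightarrow> real \<Rightarrow> real" where
  "support V t = Max ((\<lambda>v. v \<bullet> cis t) ` V)"

definition maximizers :: "complex set \<Rightarrow> real \<Rightarrow> complex set" where
  "maximizers V t = {v \<in> V. v \<bullet> cis t = support V t}"

text \<open>The one-sided derivatives of \<^const>\<open>support\<close> at \<open>t\<close>; their difference is the length of the face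
  with outer normal \<open>cis t\<close>.\<close>
definition face_hi :: "complex set \<Rightarrow> real \<Rightarrow> real" where
  "face_hi V t = Max ((\<lambda>v. v \<bullet> (\<i> * cis t)) ` maximizers V t)"

definition face_lo :: "complex set \<Rightarrow> real \<Rightarrow> real" where
  "face_lo V t = Min ((\<lambda>v. v \<bullet> (\<i> * cis t)) ` maximizers V t)"

text \<open>Angles of normals to lines through two points of \<open>V\<close>. Those that are not
  normals of edges give a zero jump, and away from \<open>critical V\<close> the maximizer is
  unique.\<close>

definition critical :: "complex set \<Rightarrow> real set" where
  "critical V = {t. \<exists>v\<in>V. \<exists>v'\<in>V. v \<noteq> v' \<and> (v - v') \<bullet> cis t = 0}"

text \<open>Expansion of \<open>cis t\<close> in the frame rotated by \<open>a\<close>. If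
  \<open>d\<close> is orthogonal to \<open>cis a\<close>, only the sine term survives, so the sign
  of the projection at a nearby angle reveals the sign of the tangential component.\<close>

lemma inner_cis_shift:
  "d \<bullet> cis t = (d \<bullet> (\<i> * cis a)) * sin (t - a) + (d \<bullet> cis a) * cos (t - a)"
proof -
  have "cis t = cis (t - a) * cis a"
    by (simp add: cis_mult)
  also have "\<dots> = sin (t - a) *\<^sub>R (\<i> * cis a) + cos (t - a) *\<^sub>R cis a"
    by (simp add: complex_eq_iff algebra_simps)
  finally show ?thesis
    by (simp add: inner_add_right)
qed

lemma complex_inner_cis_decompose:
  "x = (x \<bullet> cis t) *\<^sub>R cis t + (x \<bullet> (\<i> * cis t)) *\<^sub>R (\<i> * cis t)"
proof -
  have *: "(sin t)\<^sup>2 = 1 - (cos t)\<^sup>2" by (simp add: sin_squared_eq)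
  show ?thesis
    by (simp add: complex_eq_iff inner_complex_def algebra_simps power2_eq_square[symmetric] *)
qed

text \<open>The projection of a nonzero difference \<open>d\<close> is the restriction to the real
  axis of the entire function \<open>g\<close>, which is not constant and so has finitely many zeros
  on a compact set.\<close>

lemma finite_critical:
  assumes "finite V"
  shows "finite (critical V \<inter> {a..b})"
proof -
  have fin: "finite {t\<in>{a..b}. d \<bullet> cis t = 0}" if "d \<noteq> 0" for d
  proof -
    define g where "g z = of_real (Re d) * cos z + of_real (Im d) * sin z" for z :: complex
    have g: "g (of_real t) = of_real (d \<bullet> cis t)" for t
      by (simp add: g_def inner_complex_def cos_of_real sin_of_real)
    have "finite {z \<in> complex_of_real ` {a..b}. g z = 0}"
    proof (rule holomorphic_compact_finite_zeros[of g UNIV])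
      show "g holomorphic_on UNIV" unfolding g_def by (intro holomorphic_intros)
      show "compact (complex_of_real ` {a..b})"
        by (intro compact_continuous_image continuous_intros) auto
      show "\<not> g constant_on UNIV"
      proof
        assume "g constant_on UNIV"
        then obtain c where c: "\<And>z. g z = c" by (auto simp: constant_on_def)
        have "g 0 = g (of_real pi)" "g (of_real (pi/2)) = g (of_real (-(pi/2)))" using c by metis+
        then show False using that by (simp add: g_def complex_eq_iff cos_of_real sin_of_real)
      qed
    qed auto
    moreover have "complex_of_real ` {t\<in>{a..b}. d \<bullet> cis t = 0} \<subseteq> {z \<in> complex_of_real ` {a..b}. g z = 0}"
      using g by auto
    ultimately have "finite (complex_of_real ` {t\<in>{a..b}. d \<bullet> cis t = 0})"
      using finite_subset by blast
    then show ?thesis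
      by (rule finite_imageD) (auto simp: inj_on_def)
  qed
  have "critical V \<inter> {a..b} \<subseteq> (\<Union>(v,v')\<in>{(v,v')\<in>V\<times>V. v \<noteq> v'}. {t\<in>{a..b}. (v - v') \<bullet> cis t = 0})"
    by (auto simp: critical_def)
  moreover have "finite \<dots>"
    by (rule finite_UN_I) (use assms fin in \<open>auto intro: finite_subset[of _ "V \<times> V"]\<close>)
  ultimately show ?thesis using finite_subset by blast
qed

section \<open>Support function of a finite point set and its integral\<close>

context
  fixes V :: "complex set"
  assumes fin: "finite V" and ne: "V \<noteq> {}"
begin

lemma support_ge: "v \<in> V \<Longrightarrow> v \<bullet> cis t \<le> support V t"
  unfolding support_def using fin by auto

lemma support_eqI: "v \<in> V \<Longrightarrow> (\<And>v'. v' \<in> V \<Longrightarrow> v' \<bullet> cis t \<le> v \<bullet> cis t) \<Longrightarrow> support V t = v \<bullet> cis t"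
  unfolding support_def using fin by (intro Max_eqI) auto

lemma maximizers_nonempty: "maximizers V t \<noteq> {}"
proof -
  have "support V t \<in> (\<lambda>v. v \<bullet> cis t) ` V"
    unfolding support_def using fin ne by (intro Max_in) auto
  then show ?thesis by (auto simp: maximizers_def)
qed

lemma finite_maximizers: "finite (maximizers V t)"
  using fin by (simp add: maximizers_def)

lemma face_lo_le: "v \<in> maximizers V t \<Longrightarrow> face_lo V t \<le> v \<bullet> (\<i> * cis t)"
  unfolding face_lo_def using finite_maximizers by auto

lemma face_hi_ge: "v \<in> maximizers V t \<Longrightarrow> v \<bullet> (\<i> * cis t) \<le> face_hi V t"
  unfolding face_hi_def using finite_maximizers by auto

lemma face_hi_eqI:
  "v \<in> maximizers V t \<Longrightarrow> (\<And>v'. v' \<in> maximizers V t \<Longrightarrow> v' \<bullet> (\<i> * cis t) \<le> v \<bullet> (\<i> * cis t)) \<Longrightarrow>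
    face_hi V t = v \<bullet> (\<i> * cis t)"
  unfolding face_hi_def using finite_maximizers by (intro Max_eqI) auto

lemma face_lo_eqI:
  "v \<in> maximizers V t \<Longrightarrow> (\<And>v'. v' \<in> maximizers V t \<Longrightarrow> v \<bullet> (\<i> * cis t) \<le> v' \<bullet> (\<i> * cis t)) \<Longrightarrow>
    face_lo V t = v \<bullet> (\<i> * cis t)"
  unfolding face_lo_def using finite_maximizers by (intro Min_eqI) auto

lemma face_hi_attained: "\<exists>v\<in>maximizers V t. v \<bullet> (\<i> * cis t) = face_hi V t"
  using Max_in[of "(\<lambda>v. v \<bullet> (\<i> * cis t)) ` maximizers V t"] finite_maximizers maximizers_nonempty
  unfolding face_hi_def by fastforce

lemma face_lo_attained: "\<exists>v\<in>maximizers V t. v \<bullet> (\<i> * cis t) = face_lo V t"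
  using Min_in[of "(\<lambda>v. v \<bullet> (\<i> * cis t)) ` maximizers V t"] finite_maximizers maximizers_nonempty
  unfolding face_lo_def by fastforce

lemma face_lo_eq_hi_imp_singleton:
  assumes "maximizers V t = {v}"
  shows "face_lo V t = face_hi V t"
  by (simp add: face_lo_def face_hi_def assms)

lemma face_lo_eq_hi:
  assumes "t \<notin> critical V"
  shows "face_lo V t = face_hi V t"
proof -
  obtain v where "v \<in> maximizers V t" using maximizers_nonempty by blast
  moreover have "u = v" if "u \<in> maximizers V t" for u
    using that \<open>v \<in> maximizers V t\<close> assms
    by (fastforce simp: maximizers_def critical_def inner_diff_left)
  ultimately have "maximizers V t = {v}" by blast
  then show ?thesis by (simp add: face_lo_eq_hi_imp_singleton)
qed

text \<open>Without ties inside the interval the maximizer at the midpoint stays maximal by the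
  intermediate value theorem, and up to the endpoints by continuity. So \<open>support V\<close> is
  a single sinusoid there.\<close>

lemma support_has_integral_no_critical:
  assumes ab: "a < b" and nc: "critical V \<inter> {a<..<b} = {}"
  shows "(support V has_integral (face_hi V a - face_lo V b)) {a..b}"
proof -
  define c where "c = (a + b) / 2"
  have c: "c \<in> {a<..<b}" using ab by (auto simp: c_def)
  obtain v where v: "v \<in> maximizers V c" using maximizers_nonempty by blast
  then have vV: "v \<in> V" by (simp add: maximizers_def)
  have pos: "(v - u) \<bullet> cis t > 0" if u: "u \<in> V" "u \<noteq> v" and t: "t \<in> {a<..<b}" for u t
  proof (rule ccontr)
    assume *: "\<not> (v - u) \<bullet> cis t > 0"
    have nz: "(v - u) \<bullet> cis s \<noteq> 0" if "s \<in> {a<..<b}" for s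
    proof
      assume "(v - u) \<bullet> cis s = 0"
      then have "s \<in> critical V"
        unfolding critical_def using u(1) u(2)[symmetric] vV
        by (intro CollectI bexI[of _ v] bexI[of _ u] conjI)
      then show False using nc that by blast
    qed
    have "(v - u) \<bullet> cis c > 0"
      using nz[OF c] v support_ge[OF u(1), of c] by (auto simp: maximizers_def inner_diff_left)
    moreover have "(v - u) \<bullet> cis t < 0" using nz[OF t] * by linarith
    moreover have "connected ((\<lambda>s. (v - u) \<bullet> cis s) ` {a<..<b})"
      by (intro connected_continuous_image continuous_intros) auto
    ultimately have "0 \<in> (\<lambda>s. (v - u) \<bullet> cis s) ` {a<..<b}"
      using connectedD_interval[of _ "(v - u) \<bullet> cis t" "(v - u) \<bullet> cis c" 0] c t by fastforce
    then show False using nz by force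
  qed
  have nonneg: "(v - u) \<bullet> cis t \<ge> 0" if u: "u \<in> V" and t: "t \<in> {a..b}" for u t
  proof (cases "u = v")
    case False
    have "t \<in> closure {a<..<b}" using t ab by simp
    moreover have "continuous_on (closure {a<..<b}) (\<lambda>s. (v - u) \<bullet> cis s)"
      by (intro continuous_intros)
    ultimately show ?thesis
      using continuous_ge_on_closure[of "{a<..<b}" "\<lambda>s. (v - u) \<bullet> cis s" t 0]
        pos[OF u False] by (force intro: less_imp_le)
  qed auto
  have sup: "support V t = v \<bullet> cis t" if "t \<in> {a..b}" for t
    using nonneg[OF _ that] by (intro support_eqI vV) (auto simp: inner_diff_left)
  have max: "v \<in> maximizers V t" if "t \<in> {a..b}" for t
    using sup[OF that] vV by (simp add: maximizers_def)
  define s where "s = min (b - a) 1 / 2"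
  have s: "0 < s" "s < b - a" "s < pi" using ab pi_gt3 by (auto simp: s_def)
  then have sin: "sin s > 0" by (simp add: sin_gt_zero)
  \<comment> \<open>A maximizer \<open>u\<close> tied with \<open>v\<close> at \<open>a\<close>
    cannot be ahead of \<open>v\<close> at \<open>a + s\<close>; by \<open>inner_cis_shift\<close>
    this compares the tangential components. At \<open>b\<close> the same argument runs backwards
    and makes \<open>v\<close> the lowest point of the face.\<close>
  have hi: "face_hi V a = v \<bullet> (\<i> * cis a)"
  proof (rule face_hi_eqI)
    show "v \<in> maximizers V a" using max ab by auto
    fix u assume u: "u \<in> maximizers V a"
    have "(v - u) \<bullet> cis a = 0" using u max[of a] ab by (simp add: maximizers_def inner_diff_left)
    moreover have "(v - u) \<bullet> cis (a + s) \<ge> 0" using s u by (intro nonneg) (auto simp: maximizers_def)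
    ultimately have "((v - u) \<bullet> (\<i> * cis a)) * sin s \<ge> 0"
      using inner_cis_shift[of "v - u" "a + s" a] by simp
    then show "u \<bullet> (\<i> * cis a) \<le> v \<bullet> (\<i> * cis a)"
      using sin by (simp add: zero_le_mult_iff inner_diff_left)
  qed
  have lo: "face_lo V b = v \<bullet> (\<i> * cis b)"
  proof (rule face_lo_eqI)
    show "v \<in> maximizers V b" using max ab by auto
    fix u assume u: "u \<in> maximizers V b"
    have "(v - u) \<bullet> cis b = 0" using u max[of b] ab by (simp add: maximizers_def inner_diff_left)
    moreover have "(v - u) \<bullet> cis (b - s) \<ge> 0" using s u by (intro nonneg) (auto simp: maximizers_def)
    ultimately have "((v - u) \<bullet> (\<i> * cis b)) * sin s \<le> 0"
      using inner_cis_shift[of "v - u" "b - s" b] by simp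
    then show "v \<bullet> (\<i> * cis b) \<le> u \<bullet> (\<i> * cis b)"
      using sin by (simp add: mult_le_0_iff inner_diff_left)
  qed
  have "((\<lambda>t. v \<bullet> cis t) has_integral (- (v \<bullet> (\<i> * cis b)) - - (v \<bullet> (\<i> * cis a)))) {a..b}"
  proof (rule fundamental_theorem_of_calculus)
    show "a \<le> b" using ab by simp
    fix t
    have "((\<lambda>t. - (v \<bullet> (\<i> * cis t))) has_real_derivative v \<bullet> cis t) (at t within {a..b})"
      by (auto simp: inner_complex_def intro!: derivative_eq_intros)
    then show "((\<lambda>t. - (v \<bullet> (\<i> * cis t))) has_vector_derivative v \<bullet> cis t) (at t within {a..b})"
      by (simp add: has_real_derivative_iff_has_vector_derivative)
  qed
  then have "((\<lambda>t. v \<bullet> cis t) has_integral (face_hi V a - face_lo V b)) {a..b}"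
    by (simp add: hi lo)
  then show ?thesis
    by (rule has_integral_eq[rotated]) (simp add: sup)
qed

text \<open>Between critical angles \<^const>\<open>support\<close> is a sinusoid, so it equals minus its second derivative;
  each critical angle adds the jump of the first derivative.\<close>
lemma support_has_integral:
  assumes "a < b"
  shows "(support V has_integral
    (face_hi V a - face_hi V b + (\<Sum>t\<in>critical V \<inter> {a<..b}. face_hi V t - face_lo V t))) {a..b}"
  using assms
proof (induction "card (critical V \<inter> {a<..<b})" arbitrary: a b rule: less_induct)
  case less
  have fin': "finite (critical V \<inter> {a<..b})" for a b
    by (rule finite_subset[OF _ finite_critical[OF fin, of a b]]) auto
  have fin'': "finite (critical V \<inter> {a<..<b})" for a b
    by (rule finite_subset[OF _ finite_critical[OF fin, of a b]]) auto
  show ?case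
  proof (cases "critical V \<inter> {a<..<b} = {}")
    case True
    then have "critical V \<inter> {a<..b} = critical V \<inter> {b}" using less.prems by force
    \<comment> \<open>The summand at \<open>b\<close> turns \<open>- face_hi V b\<close> into
      \<open>- face_lo V b\<close>, as needed for a single sinusoid; if \<open>b\<close> is not
      critical, there is no summand and both values agree.\<close>
    then have "(\<Sum>t\<in>critical V \<inter> {a<..b}. face_hi V t - face_lo V t) = face_hi V b - face_lo V b"
      using face_lo_eq_hi[of b] by (cases "b \<in> critical V") auto
    then show ?thesis using support_has_integral_no_critical[OF less.prems True] by simp
  next
    case False
    then obtain c where c: "c \<in> critical V" "a < c" "c < b" by auto
    have 1: "card (critical V \<inter> {a<..<c}) < card (critical V \<inter> {a<..<b})"
      "card (critical V \<inter> {c<..<b}) < card (critical V \<inter> {a<..<b})"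
      using c by (auto intro!: psubset_card_mono fin'')
    have "critical V \<inter> {a<..b} = (critical V \<inter> {a<..c}) \<union> (critical V \<inter> {c<..b})"
      using c by auto
    moreover have "(critical V \<inter> {a<..c}) \<inter> (critical V \<inter> {c<..b}) = {}" by auto
    ultimately have "(\<Sum>t\<in>critical V \<inter> {a<..b}. face_hi V t - face_lo V t) =
      (\<Sum>t\<in>critical V \<inter> {a<..c}. face_hi V t - face_lo V t) +
      (\<Sum>t\<in>critical V \<inter> {c<..b}. face_hi V t - face_lo V t)"
      using fin' by (simp add: sum.union_disjoint)
    then show ?thesis
      using has_integral_combine[OF _ _ less.hyps[OF 1(1) c(2)] less.hyps[OF 1(2) c(3)]] c
      by (simp add: algebra_simps)
  qed
qed

text \<open>A face is the hull of its extreme points (Krein-Milman); these are extreme in the whole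
  hull as well, so they lie in \<open>V\<close> and hence among the maximizers.\<close>

lemma face_eq_hull:
  "convex hull V \<inter> {x. x \<bullet> cis t = support V t} = convex hull (maximizers V t)"
    and support_ge_hull: "x \<in> convex hull V \<Longrightarrow> x \<bullet> cis t \<le> support V t"
proof -
  have hs: "x \<bullet> cis t \<le> support V t" if "x \<in> convex hull V" for x
  proof -
    have "convex hull V \<subseteq> {x. cis t \<bullet> x \<le> support V t}"
      using support_ge by (intro hull_minimal convex_halfspace_le) (auto simp: inner_commute)
    then show ?thesis using that by (auto simp: inner_commute)
  qed
  show "x \<in> convex hull V \<Longrightarrow> x \<bullet> cis t \<le> support V t" by (rule hs)
  define F where "F = convex hull V \<inter> {x. x \<bullet> cis t = support V t}"
  have F': "F = convex hull V \<inter> {x. cis t \<bullet> x = support V t}"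
    by (simp add: F_def inner_commute)
  have face: "F face_of convex hull V"
    unfolding F' using hs by (intro face_of_Int_supporting_hyperplane_le) (auto simp: inner_commute)
  have cpt: "compact F"
    unfolding F' using fin by (intro compact_Int_closed finite_imp_compact_convex_hull closed_hyperplane)
  have cvx: "convex F" using face face_of_imp_convex by blast
  have "F = convex hull {x. x extreme_point_of F}" by (rule Krein_Milman_Minkowski[OF cpt cvx])
  also have "\<dots> \<subseteq> convex hull (maximizers V t)"
    using extreme_point_of_face[OF face]
    by (intro hull_mono) (auto simp: maximizers_def F_def dest: extreme_point_of_convex_hull)
  finally have "F \<subseteq> convex hull (maximizers V t)" .
  moreover have "convex hull (maximizers V t) \<subseteq> F"
    using cvx by (intro hull_minimal) (auto simp: maximizers_def F_def hull_inc)
  ultimately show "convex hull V \<inter> {x. x \<bullet> cis t = support V t} = convex hull (maximizers V t)"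
    by (auto simp: F_def)
qed

text \<open>The face lies on a line orthogonal to \<open>cis t\<close>, so distances in it are
  differences of tangential components, whose extreme values occur at maximizers.\<close>

lemma diameter_face: "diameter (convex hull (maximizers V t)) = face_hi V t - face_lo V t"
proof (rule antisym)
  let ?F = "convex hull (maximizers V t)"
  have bnd: "face_lo V t \<le> x \<bullet> (\<i> * cis t) \<and> x \<bullet> (\<i> * cis t) \<le> face_hi V t" if "x \<in> ?F" for x
  proof -
    have "?F \<subseteq> {x. (\<i> * cis t) \<bullet> x \<le> face_hi V t} \<inter> {x. (\<i> * cis t) \<bullet> x \<ge> face_lo V t}"
      using face_lo_le face_hi_ge
      by (intro hull_minimal convex_Int convex_halfspace_le convex_halfspace_ge)
        (auto simp: inner_commute)
    then show ?thesis using that by (auto simp: inner_commute)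
  qed
  show "diameter ?F \<le> face_hi V t - face_lo V t"
  proof (rule diameter_le)
    show "?F \<noteq> {} \<or> 0 \<le> face_hi V t - face_lo V t" using maximizers_nonempty by simp
    fix x y assume xy: "x \<in> ?F" "y \<in> ?F"
    then have "(x - y) \<bullet> cis t = 0" unfolding face_eq_hull[of t, symmetric] by (auto simp: inner_diff_left)
    then have "norm (x - y) = \<bar>(x - y) \<bullet> (\<i> * cis t)\<bar>"
      using arg_cong[OF complex_inner_cis_decompose[of "x - y" t], of norm] by (simp add: norm_mult)
    then show "norm (x - y) \<le> face_hi V t - face_lo V t"
      using bnd[OF xy(1)] bnd[OF xy(2)] by (auto simp: inner_diff_left)
  qed
  obtain v u where vu: "v \<in> maximizers V t" "v \<bullet> (\<i> * cis t) = face_hi V t"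
    "u \<in> maximizers V t" "u \<bullet> (\<i> * cis t) = face_lo V t"
    using face_hi_attained face_lo_attained by blast
  have "face_hi V t - face_lo V t = (v - u) \<bullet> (\<i> * cis t)" using vu by (simp add: inner_diff_left)
  also have "\<dots> \<le> norm (v - u) * norm (\<i> * cis t)" by (rule norm_cauchy_schwarz)
  also have "\<dots> = dist v u" by (simp add: dist_norm norm_mult)
  also have "\<dots> \<le> diameter ?F"
    using vu finite_maximizers
    by (intro diameter_bounded_bound) (auto intro: hull_inc bounded_convex_hull finite_imp_bounded)
  finally show "face_hi V t - face_lo V t \<le> diameter ?F" .
qed

text \<open>A segment is the face for two opposite normals, which matches the convention that degenerate
  polygons are traversed twice.\<close>
lemma circumference_eq_sum:
  "circumference (convex hull V) = (\<Sum>t\<in>critical V \<inter> {-pi<..pi}. face_hi V t - face_lo V t)"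
proof (cases "aff_dim (convex hull V) \<le> 1")
  case True
  then have ad: "aff_dim (convex hull V) < DIM(complex)" by simp
  obtain a b where ab: "a \<noteq> 0" "convex hull V \<subseteq> {x. a \<bullet> x = b}"
    by (rule aff_lowdim_subset_hyperplane[OF ad])
  \<comment> \<open>The normal of the line is determined up to sign; choosing its angle in
    \<open>{-pi<..0}\<close> puts both \<open>t0\<close> and \<open>t0 + pi\<close> into
    \<open>{-pi<..pi}\<close>.\<close>
  obtain t0 c where t0: "t0 \<in> {-pi<..0}" and line: "\<And>x. x \<in> convex hull V \<Longrightarrow> x \<bullet> cis t0 = c"
  proof (cases "Arg a \<le> 0")
    case True
    have "x \<bullet> cis (Arg a) = b / norm a" if "x \<in> convex hull V" for x
      using ab that by (auto simp: cis_Arg sgn_div_norm inner_commute divide_inverse)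
    then show ?thesis using that[of "Arg a"] Arg_bounded[of a] True by auto
  next
    case False
    have "x \<bullet> cis (Arg a - pi) = - b / norm a" if "x \<in> convex hull V" for x
      using ab that
      by (auto simp: minus_cis'[symmetric] cis_Arg sgn_div_norm inner_commute divide_inverse)
    then show ?thesis using that[of "Arg a - pi"] Arg_bounded[of a] False by auto
  qed
  have lineV: "v \<bullet> cis t0 = c" if "v \<in> V" for v using line[OF hull_inc[OF that]] .
  have all: "maximizers V t0 = V"
    using support_eqI[of _ t0] lineV ne by (fastforce simp: maximizers_def)
  have all': "maximizers V (t0 + pi) = V"
  proof -
    have "v \<bullet> cis (t0 + pi) = -c" if "v \<in> V" for v
      using lineV[OF that] by (simp add: minus_cis[symmetric])
    then show ?thesis
      using support_eqI[of _ "t0 + pi"] ne by (fastforce simp: maximizers_def)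
  qed
  \<comment> \<open>Any other critical angle would make a nonzero difference orthogonal to two
    independent directions.\<close>
  have crit: "t = t0 \<or> t = t0 + pi" if t: "t \<in> critical V" "t \<in> {-pi<..pi}" for t
  proof -
    obtain v u where vu: "v \<in> V" "u \<in> V" "v \<noteq> u" "(v - u) \<bullet> cis t = 0"
      using t by (auto simp: critical_def)
    have 0: "(v - u) \<bullet> cis t0 = 0" using vu lineV by (simp add: inner_diff_left)
    then have "(v - u) \<bullet> (\<i> * cis t0) \<noteq> 0"
      using vu complex_inner_cis_decompose[of "v - u" t0] by auto
    then have s: "sin (t - t0) = 0" using inner_cis_shift[of "v - u" t t0] vu 0 by simp
    then obtain k :: int where k: "t - t0 = of_int k * pi" using sin_zero_iff_int2 by blast
    have "-pi < t - t0" "t - t0 < 2 * pi" using t t0 by auto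
    then have "real_of_int k * pi > (-1) * pi" "real_of_int k * pi < 2 * pi" using k by auto
    then have "real_of_int k > -1" "real_of_int k < 2"
      by (metis mult_less_cancel_right_pos pi_gt_zero)+
    then have "k = 0 \<or> k = 1" by linarith
    then show ?thesis using k by auto
  qed
  have "(\<Sum>t\<in>critical V \<inter> {-pi<..pi}. face_hi V t - face_lo V t) =
    (\<Sum>t\<in>{t0, t0 + pi}. face_hi V t - face_lo V t)"
  proof (rule sum.mono_neutral_left)
    show "critical V \<inter> {-pi<..pi} \<subseteq> {t0, t0 + pi}"
    proof
      fix t assume "t \<in> critical V \<inter> {-pi<..pi}"
      then show "t \<in> {t0, t0 + pi}" using crit[of t] by blast
    qed
    have "{t0, t0 + pi} \<subseteq> {-pi<..pi}" using t0 by auto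
    then show "\<forall>t\<in>{t0, t0 + pi} - critical V \<inter> {-pi<..pi}. face_hi V t - face_lo V t = 0"
      using face_lo_eq_hi by fastforce
  qed simp
  also have "\<dots> = 2 * diameter (convex hull V)"
    using diameter_face[of t0] diameter_face[of "t0 + pi"] all all' by simp
  finally show ?thesis using True by (simp add: circumference_def)
next
  case False
  define K where "K = convex hull V"
  define T where "T = {t \<in> {-pi<..pi}. face_hi V t \<noteq> face_lo V t}"
  define F where "F t = convex hull (maximizers V t)" for t
  have F: "F t = K \<inter> {x. x \<bullet> cis t = support V t}" for t
    using face_eq_hull[of t] by (simp add: F_def K_def)
  have two: "\<exists>x\<in>F t. \<exists>y\<in>F t. x \<noteq> y" if "t \<in> T" for t
  proof -
    obtain v u where vu: "v \<in> maximizers V t" "v \<bullet> (\<i> * cis t) = face_hi V t"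
      "u \<in> maximizers V t" "u \<bullet> (\<i> * cis t) = face_lo V t"
      using face_hi_attained face_lo_attained by blast
    then have "v \<noteq> u" using that by (auto simp: T_def)
    then show ?thesis using vu by (auto simp: F_def intro: hull_inc)
  qed
  \<comment> \<open>Edges correspond to the outer normals whose face is not a single point.\<close>
  have "bij_betw F T {e. e edge_of K}"
  proof (rule bij_betw_imageI)
    show "inj_on F T"
    proof (rule inj_onI)
      fix t s assume ts: "t \<in> T" "s \<in> T" "F t = F s"
      obtain x y where xy: "x \<in> F t" "y \<in> F t" "x \<noteq> y" using two[OF ts(1)] by blast
      have 0: "(x - y) \<bullet> cis t = 0" using xy F[of t] by (auto simp: inner_diff_left)
      have 1: "(x - y) \<bullet> cis s = 0" using xy ts(3) F[of s] by (auto simp: inner_diff_left)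
      have "(x - y) \<bullet> (\<i> * cis t) \<noteq> 0"
        using xy 0 complex_inner_cis_decompose[of "x - y" t] by auto
      then have sin0: "sin (s - t) = 0" using inner_cis_shift[of "x - y" s t] 0 1 by simp
      then have cs: "z \<bullet> cis s = (z \<bullet> cis t) * cos (s - t)" for z
        using inner_cis_shift[of z s t] by simp
      \<comment> \<open>Equal faces force parallel normals; opposite ones would squeeze the hull
        into a line, against the assumed dimension.\<close>
      have "cos (s - t) \<noteq> -1"
      proof
        assume "cos (s - t) = -1"
        then have neg: "z \<bullet> cis s = - (z \<bullet> cis t)" for z using cs by simp
        have "support V s = x \<bullet> cis s" "support V t = x \<bullet> cis t"
          using xy(1) xy(1)[unfolded ts(3)] by (simp_all add: F)
        then have ss: "support V s = - support V t" using neg by simp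
        have "z \<bullet> cis t = support V t" if "z \<in> K" for z
          using support_ge_hull[of z t] support_ge_hull[of z s] that neg[of z] ss
          by (simp add: K_def)
        then have "K \<subseteq> {z. cis t \<bullet> z = support V t}" by (auto simp: inner_commute)
        then have "aff_dim K \<le> aff_dim {z. cis t \<bullet> z = support V t}" by (rule aff_dim_subset)
        then show False using False by (simp add: aff_dim_hyperplane K_def)
      qed
      moreover have "cos (s - t) = 1 \<or> cos (s - t) = -1"
        using sin0 sin_cos_squared_add[of "s - t"] by (simp add: power2_eq_1_iff)
      ultimately have "cos (s - t) = 1" by blast
      then have "cis s = cis t"
      proof -
        have "cis (s - t) = 1" using sin0 \<open>cos (s - t) = 1\<close> by (simp add: complex_eq_iff)
        then show ?thesis by (simp add: cis_divide[symmetric])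
      qed
      moreover have "Arg (cis s) = s" "Arg (cis t) = t"
        using ts(1,2) by (auto simp: T_def intro!: Arg_cis)
      ultimately show "t = s" by metis
    qed
    show "F ` T = {e. e edge_of K}"
    proof safe
      fix t assume t: "t \<in> T"
      have "F t face_of K"
      proof -
        have "K \<inter> {x. cis t \<bullet> x = support V t} face_of K"
          using support_ge_hull[of _ t]
          by (intro face_of_Int_supporting_hyperplane_le) (auto simp: K_def inner_commute)
        then show ?thesis using F[of t] by (simp add: inner_commute)
      qed
      moreover have "aff_dim (F t) = 1"
      proof -
        have "F t \<subseteq> {x. cis t \<bullet> x = support V t}" using F[of t] by (auto simp: inner_commute)
        then have "aff_dim (F t) \<le> aff_dim {x. cis t \<bullet> x = support V t}" by (rule aff_dim_subset)
        then have "aff_dim (F t) \<le> 1" by (simp add: aff_dim_hyperplane)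
        moreover have "aff_dim (F t) \<noteq> 0" using two[OF t] by (auto simp: aff_dim_eq_0)
        moreover have "aff_dim (F t) \<noteq> -1" using two[OF t] by (auto simp: aff_dim_empty[symmetric])
        moreover have "aff_dim (F t) \<ge> -1" by (rule aff_dim_geq)
        ultimately show ?thesis by linarith
      qed
      ultimately show "F t edge_of K" by (simp add: edge_of_def)
    next
      fix e assume e: "e edge_of K"
      have "polyhedron K"
        unfolding K_def using fin by (intro polytope_imp_polyhedron) (auto simp: polytope_def)
      \<comment> \<open>Faces of a polyhedron are exposed, and the exposing functional supplies the
        normal.\<close>
      then have "e exposed_face_of K" using e by (simp add: exposed_face_of_polyhedron edge_of_def)
      moreover have "e \<noteq> {}" "e \<noteq> K" using e False by (auto simp: edge_of_def K_def)
      ultimately obtain a b where ab: "a \<noteq> 0" "K \<subseteq> {x. a \<bullet> x \<le> b}" "e = K \<inter> {x. a \<bullet> x = b}"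
        by (auto simp: exposed_face_of)
      define t where "t = Arg a"
      have ct: "x \<bullet> cis t = (a \<bullet> x) / norm a" for x
        using ab(1) by (auto simp: t_def cis_Arg sgn_div_norm inner_commute divide_inverse)
      have sup: "support V t = b / norm a"
      proof (rule antisym)
        obtain v where "v \<in> maximizers V t" using maximizers_nonempty by blast
        then have v: "v \<in> V" "support V t = (a \<bullet> v) / norm a" by (auto simp: maximizers_def ct)
        then have "a \<bullet> v \<le> b" using ab(2) hull_inc[of v V convex] by (auto simp: K_def)
        then show "support V t \<le> b / norm a" using v by (simp add: divide_right_mono)
        obtain x where "x \<in> e" using \<open>e \<noteq> {}\<close> by blast
        then show "b / norm a \<le> support V t"
          using ab(3) support_ge_hull[of x t] by (auto simp: ct K_def)
      qed
      have "e = F t" unfolding F ab(3) ct sup using ab(1) by auto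
      moreover have "t \<in> T"
      proof -
        have "face_hi V t \<noteq> face_lo V t"
        proof
          assume "face_hi V t = face_lo V t"
          then have d: "diameter e = 0" using diameter_face[of t] \<open>e = F t\<close> by (simp add: F_def)
          have "bounded e"
            unfolding \<open>e = F t\<close> F_def using finite_maximizers
            by (intro bounded_convex_hull finite_imp_bounded)
          then have "x = y" if "x \<in> e" "y \<in> e" for x y
            using diameter_bounded_bound[OF _ that] d by simp
          then obtain x where "e = {x}" using \<open>e \<noteq> {}\<close> by blast
          then show False using e by (simp add: edge_of_def)
        qed
        then show ?thesis using Arg_bounded[of a] by (auto simp: T_def t_def)
      qed
      ultimately show "e \<in> F ` T" by blast
    qed
  qed
  then have "(\<Sum>e | e edge_of K. diameter e) = (\<Sum>t\<in>T. diameter (F t))"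
    by (rule sum.reindex_bij_betw[symmetric])
  also have "\<dots> = (\<Sum>t\<in>T. face_hi V t - face_lo V t)"
    by (simp add: F_def diameter_face)
  also have "\<dots> = (\<Sum>t\<in>critical V \<inter> {-pi<..pi}. face_hi V t - face_lo V t)"
  proof (rule sum.mono_neutral_left)
    show "finite (critical V \<inter> {-pi<..pi})"
      by (rule finite_subset[OF _ finite_critical[OF fin, of "-pi" pi]]) auto
    show "T \<subseteq> critical V \<inter> {-pi<..pi}" using face_lo_eq_hi by (force simp: T_def)
  qed (auto simp: T_def)
  finally show ?thesis using False by (simp add: circumference_def K_def)
qed

section \<open>Integrals over full turns\<close>

lemma support_periodic: "support V (t + 2 * pi) = support V t"
  by (simp add: support_def cis_mult[symmetric])

lemma support_shift_integral:
  assumes "(support V has_integral I) {a..b}"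
  shows "(support V has_integral I) {a + 2 * pi..b + 2 * pi}"
proof -
  have "((\<lambda>x. support V (1 *\<^sub>R x + - (2 * pi))) has_integral I) {a + 2 * pi..b + 2 * pi}"
    using has_integral_affinity'[of "support V" I a b 1 "- (2 * pi)"] assms
    by (simp add: algebra_simps)
  moreover have "support V (x + - (2 * pi)) = support V x" for x
    using support_periodic[of "x - 2 * pi"] by simp
  ultimately show ?thesis by simp
qed

text \<open>The values of \<open>face_hi\<close> at \<open>-pi\<close> and \<open>pi\<close> cancel
  by periodicity, which leaves the sum of jumps. The half over \<open>{-pi..0}\<close> is then moved
  by one period to reach \<open>{0..2 * pi}\<close>.\<close>

lemma support_has_integral_period:
  "(support V has_integral circumference (convex hull V)) {0..2 * pi}"
proof -
  have "cis pi = cis (-pi)" by (simp add: complex_eq_iff)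
  then have "face_hi V pi = face_hi V (-pi)"
    by (simp add: face_hi_def maximizers_def support_def)
  then have int: "(support V has_integral circumference (convex hull V)) {-pi..pi}"
    using support_has_integral[of "-pi" pi] by (simp add: circumference_eq_sum)
  have "support V integrable_on {a..b}" if "{a..b} \<subseteq> {-pi..pi}" for a b
    using integrable_subinterval_real[OF _ that] int by blast
  then obtain I J where IJ: "(support V has_integral I) {-pi..0}" "(support V has_integral J) {0..pi}"
    by (meson atLeastatMost_subset_iff order.refl pi_ge_zero neg_le_0_iff_le has_integral_integrable_integral)
  have "I + J = circumference (convex hull V)"
    using has_integral_unique[OF has_integral_combine[OF _ _ IJ] int] by simp
  moreover have "(support V has_integral I) {pi..2 * pi}"
    using support_shift_integral[OF IJ(1)] by simp
  then have "(support V has_integral J + I) {0..2 * pi}"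
    by (rule has_integral_combine[OF _ _ IJ(2), rotated 2]) auto
  ultimately show ?thesis by (simp add: add.commute)
qed

text \<open>The factor \<open>q\<close> anticipates \<open>z ^ q\<close>, which makes
  \<open>q\<close> turns while \<open>z\<close> makes one. Rescaling divides \<open>q\<close> times
  the circumference by \<open>2 * pi * q\<close>.\<close>

theorem cauchy_circumference_formula:
  assumes "q \<ge> 1"
  shows "((\<lambda>t. support V (real q * (2 * pi * t))) has_integral circumference (convex hull V) / (2 * pi)) {0..1}"
proof -
  let ?C = "circumference (convex hull V)"
  have "(support V has_integral real n * ?C) {0..real n * (2 * pi)}" for n
  proof (induction n)
    case (Suc n)
    have "(support V has_integral ?C) {real k * (2 * pi)..real (Suc k) * (2 * pi)}" for k
    proof (induction k)
      case 0
      show ?case using support_has_integral_period by simp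
    next
      case (Suc k)
      then show ?case using support_shift_integral[OF Suc] by (simp add: algebra_simps)
    qed
    from has_integral_combine[OF _ _ Suc this[of n]] show ?case
      by (simp add: algebra_simps)
  qed auto
  then have int: "(support V has_integral real q * ?C) {0..real q * (2 * pi)}" .
  define M where "M = real q * (2 * pi)"
  have "M > 0" using assms by (simp add: M_def)
  then have "((\<lambda>x. support V (M *\<^sub>R x + 0)) has_integral (real q * ?C) /\<^sub>R M) {0..1}"
    using has_integral_affinity'[of "support V" "real q * ?C" 0 M M 0] int by (simp add: M_def[symmetric])
  moreover have "(real q * ?C) /\<^sub>R M = ?C / (2 * pi)"
  proof -
    have "(real q * ?C) /\<^sub>R M = (real q * ?C) / M"
      by (simp only: real_scaleR_def divide_inverse mult.commute)
    also have "\<dots> = ?C / (2 * pi)" using assms by (simp add: M_def)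
    finally show ?thesis .
  qed
  ultimately have "((\<lambda>x. support V (M *\<^sub>R x + 0)) has_integral ?C / (2 * pi)) {0..1}" by simp
  then show ?thesis by (simp add: M_def mult.assoc)
qed

end

section \<open>Jensen's formula by Blaschke products\<close>

lemma circle_mean_value:
  assumes "F holomorphic_on A" "open A" "cball 0 r \<subseteq> A" "r > 0"
  shows "((\<lambda>t. Re (F (of_real r * cis (2 * pi * t)))) has_integral Re (F 0)) {0..1}"
proof -
  have "F holomorphic_on cball 0 r" using assms holomorphic_on_subset by blast
  then have "((\<lambda>u. F u / (u - 0)) has_contour_integral (2 * of_real pi * \<i> * F 0)) (circlepath 0 r)"
    using assms by (intro Cauchy_integral_circlepath_simple) auto
  then have "((\<lambda>t. F (circlepath 0 r t) / circlepath 0 r t * vector_derivative (circlepath 0 r) (at t))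
      has_integral (2 * of_real pi * \<i> * F 0)) {0..1}"
    by (simp add: has_contour_integral)
  moreover have c: "circlepath 0 r t = of_real r * cis (2 * pi * t)" for t
    by (simp add: circlepath cis_conv_exp mult_ac)
  have "F (circlepath 0 r t) / circlepath 0 r t * vector_derivative (circlepath 0 r) (at t) =
     (2 * of_real pi * \<i>) * F (of_real r * cis (2 * pi * t))" for t
    using assms by (simp add: c vector_derivative_circlepath) (simp add: cis_conv_exp mult_ac)
  ultimately have "((\<lambda>t. (2 * of_real pi * \<i>) * F (of_real r * cis (2 * pi * t)))
      has_integral (2 * of_real pi * \<i> * F 0)) {0..1}" by simp
  then have "((\<lambda>t. 1 / (2 * of_real pi * \<i>) * ((2 * of_real pi * \<i>) * F (of_real r * cis (2 * pi * t))))
      has_integral 1 / (2 * of_real pi * \<i>) * (2 * of_real pi * \<i> * F 0)) {0..1}"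
    by (rule has_integral_mult_right)
  then have "((\<lambda>t. F (of_real r * cis (2 * pi * t))) has_integral F 0) {0..1}"
    by simp
  then show ?thesis by (rule has_integral_Re)
qed

text \<open>The one-sided bound puts \<open>G = F - F 0\<close> into a half plane, which is mapped
  into the unit disc to give \<open>Q\<close>; the Schwarz lemma then bounds \<open>G\<close>, and
  Cauchy's estimate bounds its derivative. The constant depends on \<open>F\<close> only through
  \<open>K\<close> and \<open>c\<close>, which later gives uniformity in the radius.\<close>

lemma Borel_Caratheodory_Lipschitz:
  assumes hol: "F holomorphic_on ball 0 1" and up: "\<And>z. norm z < 1 \<Longrightarrow> Re (F z) \<le> K"
    and lo: "- c \<le> Re (F 0)" and s: "s < 1" and zw: "norm z \<le> s" "norm w \<le> s"
  shows "norm (F z - F w) \<le> 8 * (K + c + 1) / (1 - s)\<^sup>2 * norm (z - w)"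
proof -
  \<comment> \<open>The summand \<open>1\<close> makes \<open>Re (G z) < B\<close> strict.\<close>
  define B where "B = K + 1 - Re (F 0)"
  have B: "B > 0" "B \<le> K + c + 1" using up[of 0] lo by (auto simp: B_def)
  define G where "G z = F z - F 0" for z
  have G_Re: "Re (G z) < B" if "norm z < 1" for z using up[OF that] by (simp add: G_def B_def)
  have lt: "norm (G z) < norm (of_real (2 * B) - G z)" if "norm z < 1" for z
  proof -
    have "(2 * B - Re (G z))\<^sup>2 - (Re (G z))\<^sup>2 = 4 * B * (B - Re (G z))"
      by (simp add: power2_eq_square algebra_simps)
    moreover have "\<dots> > 0" using B G_Re[OF that] by simp
    ultimately show ?thesis
      by (simp add: norm_complex_def)
  qed
  define Q where "Q z = G z / (of_real (2 * B) - G z)" for z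
  have den: "of_real (2 * B) - G z \<noteq> 0" if "norm z < 1" for z
    using lt[OF that] by (metis norm_zero norm_not_less_zero)
  have Q: "norm (Q z) \<le> norm z" if z: "norm z < 1" for z
  proof (rule Schwarz_Lemma(1)[of Q])
    show "Q holomorphic_on ball 0 1"
      unfolding Q_def using den by (auto simp: G_def intro!: holomorphic_intros hol)
    show "Q 0 = 0" by (simp add: Q_def G_def)
    show "norm (Q z) < 1" if "norm z < 1" for z
      using lt[OF that] den[OF that] by (simp add: Q_def norm_divide divide_less_eq)
  qed (rule z)
  have G: "norm (G z) \<le> 2 * B / (1 - r)" if "norm z \<le> r" "r < 1" for z r
  proof -
    have z: "norm z < 1" using that by simp
    have "norm (G z) = norm (Q z) * norm (of_real (2 * B) - G z)"
      using den[OF z] by (simp add: Q_def norm_divide)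
    also have "\<dots> \<le> r * (2 * B + norm (G z))"
      using Q[OF z] that B norm_triangle_ineq4[of "of_real (2 * B)" "G z"]
      by (intro mult_mono) (auto intro: order.trans[OF norm_ge_zero])
    finally have "norm (G z) * (1 - r) \<le> r * (2 * B)" by (simp add: algebra_simps)
    also have "\<dots> \<le> 2 * B" using that B by simp
    finally show ?thesis using that by (simp add: pos_le_divide_eq)
  qed
  have hol': "G holomorphic_on ball 0 1" unfolding G_def by (intro holomorphic_intros hol)
  have "norm (G z - G w) \<le> 8 * B / (1 - s)\<^sup>2 * norm (z - w)"
  proof (rule field_differentiable_bound[where S = "cball 0 s" and f' = "deriv G"])
    fix x :: complex assume x: "x \<in> cball 0 s"
    show "(G has_field_derivative deriv G x) (at x within cball 0 s)"
      by (rule has_field_derivative_at_within, rule holomorphic_derivI[OF hol']) (use x s in auto)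
    \<comment> \<open>Half the distance left to the unit circle: \<open>2 * B / d\<close> bounds
      \<open>G\<close> on the circle of radius \<open>d\<close>, and Cauchy's estimate divides by
      \<open>d\<close> once more.\<close>
    define d where "d = (1 - s) / 2"
    have d: "d > 0" "s + d < 1" "1 - (s + d) = d" using s by (auto simp: d_def field_simps)
    have sub: "cball x d \<subseteq> ball 0 1"
    proof
      fix y assume "y \<in> cball x d"
      then have "norm y \<le> norm x + d" using norm_triangle_sub[of y x] by (simp add: dist_norm norm_minus_commute)
      then show "y \<in> ball 0 1" using x d by simp
    qed
    have "norm ((deriv ^^ 1) G x) \<le> fact 1 * (2 * B / d) / d ^ 1"
    proof (rule Cauchy_inequality)
      show "G holomorphic_on ball x d" using hol' sub by (rule holomorphic_on_subset[OF _ order.trans[OF ball_subset_cball]])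
      show "continuous_on (cball x d) G" using hol' sub holomorphic_on_imp_continuous_on holomorphic_on_subset by blast
      fix y assume "norm (x - y) = d"
      then have "norm y \<le> s + d" using x norm_triangle_sub[of y x] by (simp add: norm_minus_commute)
      then show "norm (G y) \<le> 2 * B / d" using G[of y "s + d"] d by simp
    qed (use d in auto)
    also have "\<dots> = 8 * B / (1 - s)\<^sup>2" using s by (simp add: d_def power2_eq_square field_simps)
    finally show "norm (deriv G x) \<le> 8 * B / (1 - s)\<^sup>2" by simp
  qed (use zw in auto)
  also have "\<dots> \<le> 8 * (K + c + 1) / (1 - s)\<^sup>2 * norm (z - w)"
    using B by (intro mult_right_mono divide_right_mono) auto
  finally show ?thesis by (simp add: G_def)
qed

text \<open>
  The value \<open>N(R, 1/f) + log \<bar>c\<bar>\<close> of Jensen's formula, where \<open>c\<close> is the leading Taylor coefficient of \<open>f\<close> at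
  \<open>0\<close>. Since \<^term>\<open>ln 0 = (0::real)\<close>, a zero at the origin contributes its multiplicity times \<^term>\<open>ln R\<close>.
\<close>
definition jensen :: "(complex \<Rightarrow> complex) \<Rightarrow> real \<Rightarrow> real" where
  "jensen f R = ln (norm (zor_poly f 0 0)) +
     (\<Sum>z | norm z < R \<and> f z = 0. real (nat (zorder f z)) * (ln R - ln (norm z)))"

text \<open>For \<open>norm a < R\<close> the right side is nonnegative in the disc of radius
  \<open>R\<close> and zero on its boundary: \<open>(R\<^sup>2 - cnj a * z) / R\<close> dominates
  \<open>z - a\<close> in modulus inside and matches it on the circle.\<close>

lemma Blaschke_factor_identity:
  "(norm (of_real (R\<^sup>2) - cnj a * z))\<^sup>2 - (R * norm (z - a))\<^sup>2 = (R\<^sup>2 - (norm a)\<^sup>2) * (R\<^sup>2 - (norm z)\<^sup>2)"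
  unfolding power_mult_distrib cmod_power2
  by (simp add: power2_eq_square algebra_simps)

section \<open>Zeros of an entire function and the Jensen value\<close>

context
  fixes f :: "complex \<Rightarrow> complex" and z0 :: complex
  assumes holo: "f holomorphic_on UNIV" and nz: "f z0 \<noteq> 0"
begin

lemma finite_zeros_cball: "finite {z. norm z \<le> r \<and> f z = 0}"
proof (cases "f constant_on UNIV")
  case True
  then have "f z \<noteq> 0" for z using nz by (metis UNIV_I constant_on_def)
  then show ?thesis by simp
next
  case False
  have "finite {z\<in>cball 0 r. f z = 0}"
    by (rule holomorphic_compact_finite_zeros[OF holo]) (use False in auto)
  then show ?thesis by simp
qed

lemma finite_zeros_ball: "finite {z. norm z < r \<and> f z = 0}"
  by (rule finite_subset[OF _ finite_zeros_cball[of r]]) auto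

text \<open>The difference is the integral of \<open>n(t) / t\<close> from \<open>R\<close> to
  \<open>R'\<close>, and the bounds express that \<open>n\<close> is increasing. Zero by zero, each
  contributes at most \<open>ln R' - ln R\<close>, with equality in the smaller disc.\<close>

lemma zero_count_jensen_bounds:
  assumes "0 < R" "R \<le> R'"
  shows "real (zero_count f R) * (ln R' - ln R) \<le> jensen f R' - jensen f R"
    and "jensen f R' - jensen f R \<le> real (zero_count f R') * (ln R' - ln R)"
proof -
  define m where "m z = real (nat (zorder f z))" for z
  define Z where "Z R = {z. norm z < R \<and> f z = 0}" for R
  \<comment> \<open>The contribution of one zero to the difference. A zero at the origin falls into
    the first case, where \<open>ln (norm z)\<close> has cancelled.\<close>
  define d where "d z = (if norm z < R then ln R' - ln R else ln R' - ln (norm z))" for z :: complex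
  have sub: "Z R \<subseteq> Z R'" using assms by (auto simp: Z_def)
  have fin: "finite (Z R)" for R unfolding Z_def by (rule finite_zeros_ball)
  have "(\<Sum>z\<in>Z R'. m z * (ln R' - ln (norm z))) - (\<Sum>z\<in>Z R. m z * (ln R - ln (norm z))) =
    (\<Sum>z\<in>Z R' - Z R. m z * (ln R' - ln (norm z))) + (\<Sum>z\<in>Z R. m z * (ln R' - ln R))"
    using sum.subset_diff[OF sub fin, of "\<lambda>z. m z * (ln R' - ln (norm z))"]
    by (simp add: sum_subtractf sum.distrib algebra_simps)
  also have "(\<Sum>z\<in>Z R' - Z R. m z * (ln R' - ln (norm z))) = (\<Sum>z\<in>Z R' - Z R. m z * d z)"
    by (rule sum.cong) (auto simp: Z_def d_def)
  also have "(\<Sum>z\<in>Z R. m z * (ln R' - ln R)) = (\<Sum>z\<in>Z R. m z * d z)"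
    by (rule sum.cong) (auto simp: Z_def d_def)
  also have "(\<Sum>z\<in>Z R' - Z R. m z * d z) + (\<Sum>z\<in>Z R. m z * d z) = (\<Sum>z\<in>Z R'. m z * d z)"
    using sum.subset_diff[OF sub fin, of "\<lambda>z. m z * d z"] by simp
  finally have eq: "jensen f R' - jensen f R = (\<Sum>z\<in>Z R'. m z * d z)"
    by (simp add: jensen_def m_def Z_def)
  have cnt: "real (zero_count f R) = (\<Sum>z\<in>Z R. m z)" for R
    by (simp add: zero_count_def m_def Z_def)
  have m0: "m z \<ge> 0" for z by (simp add: m_def)
  have d0: "0 \<le> d z" "d z \<le> ln R' - ln R" if "z \<in> Z R'" for z
    using that assms by (auto simp: d_def Z_def intro!: ln_mono)
  have "real (zero_count f R) * (ln R' - ln R) = (\<Sum>z\<in>Z R. m z * d z)"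
    unfolding cnt sum_distrib_right by (rule sum.cong) (auto simp: Z_def d_def)
  also have "\<dots> \<le> (\<Sum>z\<in>Z R'. m z * d z)"
    by (rule sum_mono2[OF fin sub]) (use m0 d0 in auto)
  finally show "real (zero_count f R) * (ln R' - ln R) \<le> jensen f R' - jensen f R" by (simp add: eq)
  show "jensen f R' - jensen f R \<le> real (zero_count f R') * (ln R' - ln R)"
    unfolding cnt eq sum_distrib_right by (rule sum_mono) (use m0 d0 in \<open>auto intro: mult_left_mono\<close>)
qed

lemma jensen_mono:
  assumes "0 < R" "R \<le> R'"
  shows "jensen f R \<le> jensen f R'"
proof -
  have "0 \<le> real (zero_count f R) * (ln R' - ln R)" using assms by simp
  then show ?thesis using zero_count_jensen_bounds(1)[OF assms] by linarith
qed

lemma zero_free_radius_exists: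
  assumes "a < b"
  shows "\<exists>R\<in>{a<..<b}. \<forall>z. norm z = R \<longrightarrow> f z \<noteq> 0"
proof -
  have "finite (norm ` {z. norm z \<le> b \<and> f z = 0})" using finite_zeros_cball by simp
  then have "infinite ({a<..<b} - norm ` {z. norm z \<le> b \<and> f z = 0})"
    using assms by (simp add: infinite_Ioo Diff_infinite_finite)
  then obtain R where "R \<in> {a<..<b} - norm ` {z. norm z \<le> b \<and> f z = 0}"
    using infinite_imp_nonempty by blast
  then show ?thesis by (intro bexI[of _ R]) (auto simp: image_iff)
qed

text \<open>Each zero factor \<open>z - a\<close> is exchanged for
  \<open>(R\<^sup>2 - cnj a * z) / R\<close>. The result is zero-free on a disc slightly larger than
  \<open>cball 0 R\<close>, so it has a holomorphic logarithm \<open>F\<close>, and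
  \<open>Re (F 0)\<close> is computed factor by factor.\<close>

lemma jensen_majorant:
  assumes R: "R > 0" and zf: "\<And>z. norm z = R \<Longrightarrow> f z \<noteq> 0"
  obtains A F where "open A" "cball 0 R \<subseteq> A" "F holomorphic_on A"
    "\<And>z. norm z \<le> R \<Longrightarrow> norm (f z) \<le> exp (Re (F z))"
    "\<And>z. norm z = R \<Longrightarrow> norm (f z) = exp (Re (F z))"
    "Re (F 0) = jensen f R"
proof -
  define Z where "Z = {z. norm z < R \<and> f z = 0}"
  define m where "m z = nat (zorder f z)" for z
  have finZ: "finite Z" unfolding Z_def by (rule finite_zeros_ball)
  \<comment> \<open>Moduli beyond \<open>R\<close> that the larger disc must not pass: those of
    further zeros of \<open>f\<close> and of the zeros reflected in the circle, where the new
    factors vanish. The element \<open>R + 1\<close> keeps the set nonempty and limits the zeros to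
    be considered to finitely many.\<close>
  define X where "X = insert (R + 1) ({norm z |z. norm z \<le> R + 1 \<and> f z = 0 \<and> R < norm z} \<union>
    (\<lambda>a. R\<^sup>2 / norm a) ` (Z - {0}))"
  define R1 where "R1 = Min X"
  have finX: "finite X"
  proof -
    have "{norm z |z. norm z \<le> R + 1 \<and> f z = 0 \<and> R < norm z} \<subseteq> norm ` {z. norm z \<le> R + 1 \<and> f z = 0}"
      by auto
    then have "finite {norm z |z. norm z \<le> R + 1 \<and> f z = 0 \<and> R < norm z}"
      using finite_zeros_cball finite_subset by blast
    then show ?thesis using finZ by (simp add: X_def)
  qed
  have X_gt: "x > R" if "x \<in> X" for x
  proof -
    have "R < R\<^sup>2 / norm a" if "a \<in> Z - {0}" for a
      using that R by (simp add: Z_def less_divide_eq power2_eq_square)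
    then show ?thesis using that by (auto simp: X_def)
  qed
  have "X \<noteq> {}" by (simp add: X_def)
  then have R1: "R1 > R" unfolding R1_def by (intro X_gt Min_in finX)
  have R1_le: "R1 \<le> x" if "x \<in> X" for x using that finX by (simp add: R1_def)
  define A where "A = ball (0::complex) R1"
  have A: "open A" "convex A" "connected A" "cball 0 R \<subseteq> A" using R1 by (auto simp: A_def)
  have zA: "z \<in> Z" if "z \<in> A" "f z = 0" for z
  proof (rule ccontr)
    assume "z \<notin> Z"
    then have "norm z > R" using that zf[of z] by (force simp: Z_def)
    moreover have "norm z \<le> R + 1" using that R1_le[of "R + 1"] by (simp add: A_def X_def)
    ultimately have "R1 \<le> norm z" using that by (intro R1_le) (auto simp: X_def)
    then show False using that by (simp add: A_def)
  qed
  have ord: "zorder f a = int (m a)" "m a > 0" if "a \<in> Z" for a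
  proof -
    have "zorder f a > 0"
      using zorder_exist_zero[OF holo open_UNIV connected_UNIV UNIV_I, of a] nz that
      by (auto simp: Z_def split: if_splits)
    then show "zorder f a = int (m a)" "m a > 0" by (auto simp: m_def)
  qed
  define P where "P z = (\<Prod>a\<in>Z. (z - a) ^ m a)" for z
  have P0: "P z = 0 \<longleftrightarrow> z \<in> Z" for z
    using finZ ord(2) by (auto simp: P_def)
  have holP: "P holomorphic_on S" for S unfolding P_def by (intro holomorphic_intros)
  have fA: "f holomorphic_on A" using holo by (rule holomorphic_on_subset) auto
  have fP: "f z = 0 \<longleftrightarrow> P z = 0" if "z \<in> A" for z
    using zA[OF that] by (auto simp: P0 Z_def)
  \<comment> \<open>\<open>P\<close> has the same zeros and orders as \<open>f\<close> on
    \<open>A\<close>, so the quotient \<open>g\<close> is zero-free.\<close>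
  obtain g where g: "g holomorphic_on A" "\<And>z. z \<in> A \<Longrightarrow> g z \<noteq> 0" "\<And>z. z \<in> A \<Longrightarrow> f z = g z * P z"
  proof (rule holomorphic_zorder_factorization[OF fA A(1,3) holP])
    fix z assume z: "z \<in> A"
    show "P z = 0 \<longleftrightarrow> f z = 0" using fP[OF z] by simp
    show "zorder P z = zorder f z"
    proof (cases "z \<in> Z")
      case True
      have "zorder P z = int (m z)"
      proof (rule zorder_eqI[of UNIV z "\<lambda>w. \<Prod>a\<in>Z-{z}. (w - a) ^ m a"])
        show "(\<Prod>a\<in>Z - {z}. (z - a) ^ m a) \<noteq> 0" using finZ by auto
        show "P w = (\<Prod>a\<in>Z - {z}. (w - a) ^ m a) * (w - z) powi int (m z)" for w
          using finZ True by (simp add: P_def prod.remove[of Z z] mult.commute)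
      qed (auto intro!: holomorphic_intros)
      then show ?thesis using ord(1)[OF True] by simp
    next
      case False
      then have "f z \<noteq> 0" "P z \<noteq> 0" using zA[OF z] P0 by auto
      moreover have "f analytic_on {z}" "P analytic_on {z}"
        using holo holP[of UNIV] by (auto simp: analytic_on_open[symmetric] intro: analytic_on_subset)
      ultimately show ?thesis by (simp add: zorder_eq_0I)
    qed
  qed blast
  define B where "B z = (\<Prod>a\<in>Z. ((of_real (R\<^sup>2) - cnj a * z) / of_real R) ^ m a)" for z
  have B_nz: "B z \<noteq> 0" if z: "z \<in> A" for z
  proof -
    have "of_real (R\<^sup>2) - cnj a * z \<noteq> 0" if a: "a \<in> Z" for a
    proof
      assume "of_real (R\<^sup>2) - cnj a * z = 0"
      then have "norm (of_real (R\<^sup>2) :: complex) = norm (cnj a * z)" by simp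
      then have eq: "R\<^sup>2 = norm a * norm z" by (simp add: norm_mult norm_power)
      then have "a \<noteq> 0" using R by auto
      then have "R1 \<le> R\<^sup>2 / norm a" using a by (intro R1_le) (auto simp: X_def)
      also have "\<dots> = norm z" using eq \<open>a \<noteq> 0\<close> by (simp add: field_simps)
      finally show False using z by (simp add: A_def)
    qed
    then show ?thesis using finZ R by (simp add: B_def)
  qed
  have "(\<lambda>z. g z * B z) holomorphic_on A" unfolding B_def using R g(1) by (intro holomorphic_intros) auto
  then obtain F where F: "F holomorphic_on A" "\<And>z. z \<in> A \<Longrightarrow> exp (F z) = g z * B z"
  proof (rule holomorphic_logarithm_exists[OF A(2,1)])
    show "g z * B z \<noteq> 0" if "z \<in> A" for z using g(2) B_nz that by simp
    show "0 \<in> A" using R1 R by (simp add: A_def)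
  qed blast
  have expF: "exp (Re (F z)) = norm (g z) * norm (B z)" if "z \<in> A" for z
    using F(2)[OF that] by (metis norm_exp_eq_Re norm_mult)
  have factor: "norm (z - a) \<le> norm ((of_real (R\<^sup>2) - cnj a * z) / of_real R)"
    "norm z = R \<Longrightarrow> norm (z - a) = norm ((of_real (R\<^sup>2) - cnj a * z) / of_real R)"
    if "a \<in> Z" "norm z \<le> R" for a z
  proof -
    let ?u = "norm (of_real (R\<^sup>2) - cnj a * z)"
    have aR: "norm a < R" using that by (simp add: Z_def)
    have "0 \<le> (R\<^sup>2 - (norm a)\<^sup>2) * (R\<^sup>2 - (norm z)\<^sup>2)"
      using aR that R by (intro mult_nonneg_nonneg) (auto simp: power_mono)
    then have "(R * norm (z - a))\<^sup>2 \<le> ?u\<^sup>2"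
      using Blaschke_factor_identity[of R a z] by linarith
    then have "R * norm (z - a) \<le> ?u" by (rule power2_le_imp_le) simp
    then show "norm (z - a) \<le> norm ((of_real (R\<^sup>2) - cnj a * z) / of_real R)"
      using R by (simp add: norm_divide pos_le_divide_eq mult.commute)
    assume "norm z = R"
    then have "(R * norm (z - a))\<^sup>2 = ?u\<^sup>2" using Blaschke_factor_identity[of R a z] by simp
    then have "R * norm (z - a) = ?u" using R by (simp add: power2_eq_iff_nonneg)
    then show "norm (z - a) = norm ((of_real (R\<^sup>2) - cnj a * z) / of_real R)"
      using R by (simp add: norm_divide nonzero_eq_divide_eq mult.commute)
  qed
  show ?thesis
  proof (rule that[OF A(1,4) F(1)])
    fix z :: complex assume z: "norm z \<le> R"
    then have zin: "z \<in> A" using A(4) by auto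
    have "norm (P z) \<le> norm (B z)"
      unfolding P_def B_def prod_norm[symmetric] norm_power
      using factor(1)[OF _ z] by (intro prod_mono conjI power_mono) auto
    then show "norm (f z) \<le> exp (Re (F z))"
      unfolding g(3)[OF zin] expF[OF zin] norm_mult by (intro mult_left_mono) auto
  next
    fix z :: complex assume z: "norm z = R"
    then have zin: "z \<in> A" using A(4) by auto
    have "norm (P z) = norm (B z)"
      unfolding P_def B_def prod_norm[symmetric] norm_power
      using factor(2)[OF _ _ z] z by (intro prod.cong) auto
    then show "norm (f z) = exp (Re (F z))"
      unfolding g(3)[OF zin] expF[OF zin] norm_mult by simp
  next
    have 0: "0 \<in> A" using R1 R by (simp add: A_def)
    \<comment> \<open>The factor of a zero at the origin is split off, because
      \<open>zor_poly f 0 0\<close> is the limit of \<open>f z / z ^ k\<close> at \<open>0\<close>,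
      with \<open>k\<close> the order there.\<close>
    define P1 where "P1 z = (\<Prod>a\<in>Z - {0}. (z - a) ^ m a)" for z
    have PP: "P z = z ^ nat (zorder f 0) * P1 z" for z
    proof (cases "0 \<in> Z")
      case True
      then show ?thesis using finZ by (simp add: P_def P1_def prod.remove[of Z 0] m_def)
    next
      case False
      then have "f 0 \<noteq> 0" using R by (simp add: Z_def)
      then have "zorder f 0 = 0"
        using holo by (intro zorder_eq_0I) (auto simp: analytic_on_open[symmetric] intro: analytic_on_subset)
      then show ?thesis using False by (simp add: P_def P1_def)
    qed
    have zp: "zor_poly f 0 0 = g 0 * P1 0"
    proof (rule zor_poly_zero_eqI[of f UNIV 0 "\<lambda>x. x" _ "at 0"])
      have "((\<lambda>z. g z * P1 z) \<longlongrightarrow> g 0 * P1 0) (at 0)"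
      proof -
        have "continuous_on A (\<lambda>z. g z * P1 z)"
          unfolding P1_def by (intro continuous_intros holomorphic_on_imp_continuous_on g)
        then show ?thesis using 0 A(1) by (simp add: continuous_on_def at_within_open[symmetric])
      qed
      moreover have "eventually (\<lambda>z. g z * P1 z = f z / (z - 0) ^ nat (zorder f 0)) (at 0)"
        unfolding eventually_at_topological
        using g(3) A(1) 0 by (intro exI[of _ A]) (auto simp: PP)
      ultimately show "((\<lambda>z. f z / (z - 0) ^ nat (zorder f 0)) \<longlongrightarrow> g 0 * P1 0) (at 0)"
        by (rule Lim_transform_eventually)
    qed (use holo nz in \<open>auto simp: filterlim_ident\<close>)
    have P1: "ln (norm (P1 0)) = (\<Sum>a\<in>Z. real (m a) * ln (norm a))"
    proof -
      have "ln (norm (P1 0)) = (\<Sum>a\<in>Z - {0}. real (m a) * ln (norm a))"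
        unfolding P1_def prod_norm[symmetric] norm_power using finZ
        by (subst ln_prod) (auto simp: ln_realpow)
      \<comment> \<open>A zero at the origin may be put back because
        \<open>ln 0 = 0\<close>.\<close>
      also have "\<dots> = (\<Sum>a\<in>Z. real (m a) * ln (norm a))"
        using finZ by (intro sum.mono_neutral_left) auto
      finally show ?thesis .
    qed
    have P10: "P1 0 \<noteq> 0" using finZ by (auto simp: P1_def)
    have B0: "ln (norm (B 0)) = (\<Sum>a\<in>Z. real (m a) * ln R)"
    proof -
      have "norm (B 0) = (\<Prod>a\<in>Z. R ^ m a)"
        unfolding B_def prod_norm[symmetric] norm_power using R
        by (simp add: norm_divide norm_power power2_eq_square norm_mult)
      also have "ln \<dots> = (\<Sum>a\<in>Z. real (m a) * ln R)"
        using finZ R by (subst ln_prod) (auto simp: ln_realpow)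
      finally show ?thesis .
    qed
    have "Re (F 0) = ln (norm (g 0) * norm (B 0))" using expF[OF 0] by (metis ln_exp)
    also have "\<dots> = ln (norm (g 0)) + (\<Sum>a\<in>Z. real (m a) * ln R)"
      using g(2)[OF 0] B_nz[OF 0] by (simp add: ln_mult B0)
    also have "\<dots> = ln (norm (zor_poly f 0 0)) + (\<Sum>a\<in>Z. real (m a) * (ln R - ln (norm a)))"
      using g(2)[OF 0] P10 by (simp add: zp norm_mult ln_mult P1 right_diff_distrib sum_subtractf)
    finally show "Re (F 0) = jensen f R" by (simp add: jensen_def Z_def m_def)
  qed
qed

end

section \<open>Zeros of entire functions with a homogeneous indicator\<close>

context
  fixes f :: "complex \<Rightarrow> complex" and h :: "complex \<Rightarrow> real" and q :: nat and L :: real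
  assumes holo: "f holomorphic_on UNIV" and q: "q \<ge> 1"
    and cont: "continuous_on UNIV h"
    and hom: "\<And>R z. R > 0 \<Longrightarrow> h (of_real R * z) = R ^ q * h z"
    and up: "\<And>e. e > 0 \<Longrightarrow>
      \<forall>\<^sub>F R in at_top. \<forall>z. norm z = R \<longrightarrow> norm (f z) \<le> exp (h z + e * R ^ q)"
    and low: "\<And>e s \<zeta>. e > 0 \<Longrightarrow> s > 0 \<Longrightarrow> \<zeta> \<noteq> 0 \<Longrightarrow>
      \<forall>\<^sub>F R in at_top. \<exists>z. norm (z - of_real R * \<zeta>) < s * R \<and> exp ((h \<zeta> - e) * R ^ q) \<le> norm (f z)"
    and L: "((\<lambda>t. h (cis (2 * pi * t))) has_integral L) {0..1}"
begin

lemma not_identically_zero: "\<exists>z. f z \<noteq> 0"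
proof -
  obtain z and R :: real where "exp ((h 1 - 1) * R ^ q) \<le> norm (f z)"
    using eventually_happens'[OF _ low[of 1 1 1]] by (auto simp: trivial_limit_at_top_linorder)
  then show ?thesis by (metis exp_gt_zero norm_zero not_le)
qed

text \<open>On a zero-free circle the real part of \<open>F\<close> equals
  \<open>ln (norm (f z))\<close>, so the mean of the latter is the Jensen value. It remains to
  integrate the bound \<open>up\<close>, rescaled by \<open>hom\<close>.\<close>

lemma jensen_upper:
  assumes "e > 0"
  shows "\<forall>\<^sub>F R in at_top. (\<forall>z. norm z = R \<longrightarrow> f z \<noteq> 0) \<longrightarrow> jensen f R \<le> (L + e) * R ^ q"
  using up[OF assms] eventually_gt_at_top[of 0]
proof eventually_elim
  case (elim R)
  obtain z0 where z0: "f z0 \<noteq> 0" using not_identically_zero by blast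
  show ?case
  proof
    assume zf: "\<forall>z. norm z = R \<longrightarrow> f z \<noteq> 0"
    obtain A F where AF: "open A" "cball 0 R \<subseteq> A" "F holomorphic_on A"
      "\<And>z. norm z = R \<Longrightarrow> norm (f z) = exp (Re (F z))" "Re (F 0) = jensen f R"
      using jensen_majorant[OF holo z0 elim(2)] zf by metis
    have "((\<lambda>t. Re (F (of_real R * cis (2 * pi * t)))) has_integral jensen f R) {0..1}"
      using circle_mean_value[OF AF(3,1,2) elim(2)] AF(5) by simp
    moreover have "((\<lambda>t. R ^ q * (h (cis (2 * pi * t)) + e)) has_integral R ^ q * (L + 1 *\<^sub>R e)) {0..1}"
      by (intro has_integral_mult_right has_integral_add L) (use has_integral_const_real[of e 0 1] in simp)
    moreover have "Re (F (of_real R * cis (2 * pi * t))) \<le> R ^ q * (h (cis (2 * pi * t)) + e)" for t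
    proof -
      let ?z = "of_real R * cis (2 * pi * t)"
      have nz: "norm ?z = R" using elim by (simp add: norm_mult)
      then have "exp (Re (F ?z)) \<le> exp (h ?z + e * R ^ q)" using AF(4) elim(1) by metis
      then show ?thesis using hom[OF elim(2)] by (simp add: algebra_simps)
    qed
    ultimately have "jensen f R \<le> R ^ q * (L + 1 *\<^sub>R e)" by (rule has_integral_le)
    then show "jensen f R \<le> (L + e) * R ^ q" by (simp add: mult.commute)
  qed
qed

text \<open>The normalised majorant \<open>G w = F (R * w) / R ^ q\<close> has real part at most
  \<open>K\<close> and \<open>Re (G 0) \<ge> -1\<close>, so it is Lipschitz on
  \<open>cball 0 s'\<close> with a constant independent of \<open>R\<close>. A lower bound at one
  point near each point of a fixed finite net thus extends to the circle of radius
  \<open>s < 1\<close>, and the mean of \<open>Re G\<close> over that circle is still its value at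
  \<open>0\<close>.\<close>

lemma jensen_lower:
  assumes "e > 0"
  shows "\<forall>\<^sub>F R in at_top. (\<forall>z. norm z = R \<longrightarrow> f z \<noteq> 0) \<longrightarrow> (L - e) * R ^ q \<le> jensen f R"
proof -
  obtain z0 where z0: "f z0 \<noteq> 0" using not_identically_zero by blast
  \<comment> \<open>Three losses of \<open>e'\<close> occur: in \<open>low\<close>, in the Lipschitz
    bound and in the continuity of \<open>h\<close>. Passing from the unit circle to radius
    \<open>s\<close> costs \<open>e / 2\<close>.\<close>
  define e' where "e' = e / 8"
  have e': "e' > 0" using assms by (simp add: e'_def)
  obtain s where s: "0 < s" "s < 1" "s ^ q * L \<ge> L - e / 2"
  proof -
    have "((\<lambda>s. s ^ q * L) \<longlongrightarrow> 1 ^ q * L) (at_left (1::real))" by (intro tendsto_intros)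
    then have "\<forall>\<^sub>F s in at_left (1::real). s ^ q * L > L - e / 2"
      using assms by (intro order_tendstoD) auto
    moreover have "\<forall>\<^sub>F s in at_left (1::real). s \<in> {0<..<1}" by (intro eventually_at_leftI[of 0]) auto
    ultimately have "\<forall>\<^sub>F s in at_left (1::real). 0 < s \<and> s < 1 \<and> s ^ q * L \<ge> L - e / 2"
      by eventually_elim auto
    then show ?thesis using that eventually_happens'[of "at_left (1::real)"] by auto
  qed
  \<comment> \<open>The margin \<open>1\<close> absorbs the error term of \<open>up\<close> with
    \<open>e = 1\<close>.\<close>
  obtain K where K: "\<And>z. norm z = 1 \<Longrightarrow> h z \<le> K - 1" "K \<ge> 1"
  proof -
    have "bounded (h ` sphere 0 1)"
      by (intro compact_imp_bounded compact_continuous_image continuous_on_subset[OF cont]) auto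
    then obtain B where B: "\<forall>z\<in>sphere 0 1. \<bar>h z\<bar> \<le> B" by (auto simp: bounded_iff)
    have "h z \<le> (\<bar>B\<bar> + 1) - 1" if "norm z = 1" for z
    proof -
      have "\<bar>h z\<bar> \<le> B" using B that by simp
      then show ?thesis by linarith
    qed
    then show ?thesis using that[of "\<bar>B\<bar> + 1"] by simp
  qed
  \<comment> \<open>Points supplied by \<open>low\<close> only lie near the circle of radius
    \<open>s\<close>; the disc of radius \<open>s'\<close> has room for them and stays away from the
    unit circle.\<close>
  define s' where "s' = (1 + s) / 2"
  define M where "M = 8 * (K + 1 + 1) / (1 - s')\<^sup>2"
  have s': "s < s'" "s' < 1" using s by (auto simp: s'_def)
  have M: "M > 0" using s' K by (simp add: M_def)
  have "uniformly_continuous_on (cball 0 1) h"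
    by (intro compact_uniformly_continuous continuous_on_subset[OF cont]) auto
  then obtain d where d: "d > 0" "\<And>z w. norm z \<le> 1 \<Longrightarrow> norm w \<le> 1 \<Longrightarrow> norm (z - w) < d \<Longrightarrow> \<bar>h z - h w\<bar> < e'"
    using e' unfolding uniformly_continuous_on_def by (auto simp: dist_norm)
  define \<eta> where "\<eta> = min d (min (s' - s) (e' / (2 * M)))"
  have \<eta>: "\<eta> > 0" "\<eta> \<le> d" "s + \<eta> \<le> s'" using d s' M e' by (auto simp: \<eta>_def)
  have M\<eta>: "M * (2 * \<eta>) \<le> e'"
  proof -
    have "\<eta> \<le> e' / (2 * M)" by (simp add: \<eta>_def)
    then show ?thesis using M by (simp add: field_simps)
  qed
  have "sphere (0::complex) s \<subseteq> (\<Union>\<zeta>\<in>sphere 0 s. ball \<zeta> \<eta>)" using \<eta>(1) by force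
  then obtain D :: "complex set" where "D \<subseteq> sphere 0 s" "finite D" "sphere 0 s \<subseteq> (\<Union>\<zeta>\<in>D. ball \<zeta> \<eta>)"
    by (rule compactE_image[OF compact_sphere open_ball])
  note D = this(2,1,3)
  have "\<forall>\<^sub>F R in at_top. \<forall>\<zeta>\<in>D. \<exists>z. norm (z - of_real R * \<zeta>) < \<eta> * R \<and> exp ((h \<zeta> - e') * R ^ q) \<le> norm (f z)"
    unfolding eventually_ball_finite_distrib[OF D(1)]
  proof
    fix \<zeta> assume "\<zeta> \<in> D"
    then have "\<zeta> \<noteq> 0" using D(2) s(1) by auto
    then show "\<forall>\<^sub>F R in at_top. \<exists>z. norm (z - of_real R * \<zeta>) < \<eta> * R \<and> exp ((h \<zeta> - e') * R ^ q) \<le> norm (f z)"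
      by (rule low[OF e' \<eta>(1)])
  qed
  \<comment> \<open>Since \<open>jensen f\<close> is increasing, this yields
    \<open>Re (G 0) \<ge> -1\<close>, the lower bound that the Lipschitz estimate needs.\<close>
  moreover have "\<forall>\<^sub>F R in at_top. - jensen f 1 \<le> R ^ q"
  proof -
    have "filterlim (\<lambda>R::real. R ^ q) at_top at_top"
      using q by (intro filterlim_pow_at_top filterlim_ident) auto
    then show ?thesis by (simp add: filterlim_at_top)
  qed
  ultimately show ?thesis using up[of 1, OF zero_less_one] eventually_ge_at_top[of 1]
  proof eventually_elim
    case (elim R)
    then have R: "R > 0" by simp
    show ?case
    proof
      assume zf: "\<forall>z. norm z = R \<longrightarrow> f z \<noteq> 0"
      obtain A F where AF: "open A" "cball 0 R \<subseteq> A" "F holomorphic_on A"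
        "\<And>z. norm z \<le> R \<Longrightarrow> norm (f z) \<le> exp (Re (F z))"
        "\<And>z. norm z = R \<Longrightarrow> norm (f z) = exp (Re (F z))" "Re (F 0) = jensen f R"
        using jensen_majorant[OF holo z0 R] zf by metis
      have F_le: "Re (F z) \<le> K * R ^ q" if "norm z \<le> R" for z
      proof (rule maximum_real_frontier[of F "cball 0 R"])
        show "F holomorphic_on interior (cball 0 R)"
          using AF(3) order.trans[OF interior_subset AF(2)] by (rule holomorphic_on_subset)
        show "continuous_on (closure (cball 0 R)) F"
          using AF(2,3) by (auto intro: continuous_on_subset holomorphic_on_imp_continuous_on)
        fix z :: complex assume "z \<in> frontier (cball 0 R)"
        then have z: "norm z = R" using R by (simp add: frontier_cball)
        then have "h z = R ^ q * h (z / of_real R)" using hom[OF R, of "z / of_real R"] R by simp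
        also have "\<dots> \<le> R ^ q * (K - 1)" using K(1)[of "z / of_real R"] z R by (simp add: norm_divide)
        finally have "h z + 1 * R ^ q \<le> K * R ^ q" by (simp add: algebra_simps)
        moreover have "exp (Re (F z)) \<le> exp (h z + 1 * R ^ q)" using AF(5)[OF z] elim(3) z by metis
        ultimately show "Re (F z) \<le> K * R ^ q" by simp
      qed (use that in auto)
      define G where "G w = F (of_real R * w) / of_real (R ^ q)" for w
      have G_Re: "Re (G w) = Re (F (of_real R * w)) / R ^ q" for w
        unfolding G_def by (rule Re_divide_of_real)
      have sub: "of_real R * w \<in> cball 0 R" if "norm w \<le> 1" for w :: complex
        using that R by (simp add: norm_mult)
      have G_Lip: "norm (G z - G w) \<le> M * norm (z - w)" if "norm z \<le> s'" "norm w \<le> s'" for z w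
        unfolding M_def
      proof (rule Borel_Caratheodory_Lipschitz[OF _ _ _ s'(2) that])
        have "(F \<circ> (\<lambda>w. of_real R * w)) holomorphic_on ball 0 1"
          using sub AF(2) by (intro holomorphic_on_compose_gen[OF _ AF(3)] holomorphic_intros) force
        then show "G holomorphic_on ball 0 1"
          unfolding G_def comp_def using R by (intro holomorphic_intros) auto
        show "Re (G z) \<le> K" if "norm z < 1" for z
          using F_le[of "of_real R * z"] sub[of z] that R by (simp add: G_Re pos_divide_le_eq)
        have "- (R ^ q) \<le> jensen f R" using jensen_mono[OF holo z0, of 1 R] elim(2,4) by simp
        then show "- 1 \<le> Re (G 0)" using R by (simp add: G_Re AF(6) pos_le_divide_eq)
      qed
      have G_ge: "h \<zeta> - 3 * e' \<le> Re (G \<zeta>)" if \<zeta>: "norm \<zeta> = s" for \<zeta>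
      proof -
        obtain \<xi> where \<xi>: "\<xi> \<in> D" "norm (\<zeta> - \<xi>) < \<eta>"
          using D(3) \<zeta> by (force simp: dist_norm norm_minus_commute)
        then have n\<xi>: "norm \<xi> = s" using D(2) by auto
        obtain z where z: "norm (z - of_real R * \<xi>) < \<eta> * R" "exp ((h \<xi> - e') * R ^ q) \<le> norm (f z)"
          using elim(1) \<xi>(1) by blast
        define w where "w = z / of_real R"
        have zw: "z = of_real R * w" using R by (simp add: w_def)
        have "norm (z - of_real R * \<xi>) = R * norm (w - \<xi>)"
          using R by (simp add: zw right_diff_distrib[symmetric] norm_mult)
        then have w\<xi>: "norm (w - \<xi>) < \<eta>" using z(1) R by (simp add: mult.commute)
        have nw: "norm w \<le> s'" using norm_triangle_sub[of w \<xi>] w\<xi> n\<xi> \<eta>(3) by linarith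
        have "norm z \<le> R" using nw s' R by (simp add: zw norm_mult)
        then have "exp ((h \<xi> - e') * R ^ q) \<le> exp (Re (F z))" using z(2) AF(4) order.trans by blast
        then have 1: "h \<xi> - e' \<le> Re (G w)" using R by (simp add: G_Re zw pos_le_divide_eq)
        have "norm (\<zeta> - w) \<le> 2 * \<eta>"
          using norm_triangle_ineq[of "\<zeta> - \<xi>" "\<xi> - w"] \<xi>(2) w\<xi> by (simp add: norm_minus_commute)
        then have "norm (G \<zeta> - G w) \<le> e'"
          using G_Lip[of \<zeta> w] \<zeta> nw s'(1) M M\<eta> mult_left_mono[of "norm (\<zeta> - w)" "2 * \<eta>" M] by linarith
        then have 2: "Re (G w) - e' \<le> Re (G \<zeta>)"
          using abs_Re_le_cmod[of "G \<zeta> - G w"] by simp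
        have 3: "h \<zeta> - e' \<le> h \<xi>" using d(2)[of \<zeta> \<xi>] \<zeta> n\<xi> s \<xi>(2) \<eta>(2) by simp
        show ?thesis using 1 2 3 by linarith
      qed
      have F_int: "((\<lambda>t. Re (F (of_real (s * R) * cis (2 * pi * t)))) has_integral jensen f R) {0..1}"
      proof -
        have "cball 0 (s * R) \<subseteq> A"
          using s R mult_right_mono[of s 1 R] by (intro order.trans[OF subset_cball AF(2)]) simp
        then show ?thesis using circle_mean_value[OF AF(3,1), of "s * R"] AF(6) s R by simp
      qed
      have h_int: "((\<lambda>t. R ^ q * (s ^ q * h (cis (2 * pi * t)) - 3 * e')) has_integral
          R ^ q * (s ^ q * L - 1 *\<^sub>R (3 * e'))) {0..1}"
        by (intro has_integral_mult_right has_integral_diff L) (use has_integral_const_real[of "3 * e'" 0 1] in simp)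
      have "R ^ q * (s ^ q * h (cis (2 * pi * t)) - 3 * e') \<le> Re (F (of_real (s * R) * cis (2 * pi * t)))" for t
      proof -
        have "s ^ q * h (cis (2 * pi * t)) - 3 * e' \<le> Re (G (of_real s * cis (2 * pi * t)))"
          using G_ge[of "of_real s * cis (2 * pi * t)"] s hom[OF s(1)] by (simp add: norm_mult)
        then show ?thesis using R by (simp add: G_Re pos_le_divide_eq mult_ac)
      qed
      then have "R ^ q * (s ^ q * L - 1 *\<^sub>R (3 * e')) \<le> jensen f R"
        by (rule has_integral_le[OF h_int F_int])
      moreover have "R ^ q * (L - e) \<le> R ^ q * (s ^ q * L - 1 *\<^sub>R (3 * e'))"
        using s(3) assms R by (intro mult_left_mono) (auto simp: e'_def)
      ultimately show "(L - e) * R ^ q \<le> jensen f R" by (simp add: mult.commute)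
    qed
  qed
qed

text \<open>The two estimates hold on zero-free circles, whose radii are dense. As
  \<open>jensen f\<close> is increasing, any other radius is compared with zero-free ones slightly
  larger for the upper bound and slightly smaller for the lower one.\<close>

lemma jensen_asymptotics:
  assumes "e > 0"
  shows "\<exists>R0>0. \<forall>R\<ge>R0. (L - e) * R ^ q \<le> jensen f R \<and> jensen f R \<le> (L + e) * R ^ q"
proof -
  obtain z0 where z0: "f z0 \<noteq> 0" using not_identically_zero by blast
  have "\<forall>\<^sub>F R in at_top. (\<forall>z. norm z = R \<longrightarrow> f z \<noteq> 0) \<longrightarrow>
      (L - e) * R ^ q \<le> jensen f R \<and> jensen f R \<le> (L + e) * R ^ q"
    using jensen_upper[OF assms] jensen_lower[OF assms] by eventually_elim auto
  then obtain R1 where R1: "\<And>R. R \<ge> R1 \<Longrightarrow> (\<forall>z. norm z = R \<longrightarrow> f z \<noteq> 0) \<Longrightarrow>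
      (L - e) * R ^ q \<le> jensen f R \<and> jensen f R \<le> (L + e) * R ^ q"
    unfolding eventually_at_top_linorder by blast
  \<comment> \<open>At least \<open>R1 + 1\<close>, so that radii in \<open>{R - 1<..<R}\<close>
    still exceed \<open>R1\<close>.\<close>
  define R0 where "R0 = max R1 0 + 1"
  have R0: "R1 + 1 \<le> R0" "1 \<le> R0" by (auto simp: R0_def)
  have "(L - e) * R ^ q \<le> jensen f R \<and> jensen f R \<le> (L + e) * R ^ q" if R: "R \<ge> R0" for R
  proof
    show "jensen f R \<le> (L + e) * R ^ q"
    proof (rule ccontr)
      assume "\<not> jensen f R \<le> (L + e) * R ^ q"
      moreover have "((\<lambda>x. (L + e) * x ^ q) \<longlongrightarrow> (L + e) * R ^ q) (at_right R)"
        by (intro tendsto_intros)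
      ultimately have "\<forall>\<^sub>F x in at_right R. (L + e) * x ^ q < jensen f R"
        by (intro order_tendstoD) auto
      then obtain b where b: "b > R" "\<And>x. R < x \<Longrightarrow> x < b \<Longrightarrow> (L + e) * x ^ q < jensen f R"
        by (auto simp: eventually_at_right_field)
      obtain x where x: "x \<in> {R<..<b}" "\<forall>z. norm z = x \<longrightarrow> f z \<noteq> 0"
        using zero_free_radius_exists[OF holo z0 b(1)] by blast
      have "jensen f x \<le> (L + e) * x ^ q" using R1[of x] x R R0 by simp
      moreover have "jensen f R \<le> jensen f x" using x R by (intro jensen_mono[OF holo z0]) (use R0 in auto)
      ultimately show False using b(2)[of x] x by simp
    qed
    show "(L - e) * R ^ q \<le> jensen f R"
    proof (rule ccontr)
      assume "\<not> (L - e) * R ^ q \<le> jensen f R"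
      moreover have "((\<lambda>x. (L - e) * x ^ q) \<longlongrightarrow> (L - e) * R ^ q) (at_left R)"
        by (intro tendsto_intros)
      ultimately have "\<forall>\<^sub>F x in at_left R. jensen f R < (L - e) * x ^ q"
        by (intro order_tendstoD) auto
      then obtain b where b: "b < R" "\<And>x. b < x \<Longrightarrow> x < R \<Longrightarrow> jensen f R < (L - e) * x ^ q"
        by (auto simp: eventually_at_left_field)
      have "max b (R - 1) < R" using b by simp
      then obtain x where x: "x \<in> {max b (R - 1)<..<R}" "\<forall>z. norm z = x \<longrightarrow> f z \<noteq> 0"
        using zero_free_radius_exists[OF holo z0] by blast
      have "(L - e) * x ^ q \<le> jensen f x" using R1[of x] x R R0 by simp
      moreover have "jensen f x \<le> jensen f R" using x R by (intro jensen_mono[OF holo z0]) (use R0 in auto)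
      ultimately show False using b(2)[of x] x by simp
    qed
  qed
  then show ?thesis by (intro exI[of _ R0]) (auto simp: R0_def)
qed

text \<open>By \<open>zero_count_jensen_bounds\<close>, \<open>n(R) * u\<close> lies between the
  increments of \<open>jensen f\<close> from \<open>exp (- u) * R\<close> to \<open>R\<close> and
  from \<open>R\<close> to \<open>exp u * R\<close>. Divided by \<open>u * R ^ q\<close> these are
  \<open>\<phi> (- u)\<close> and \<open>\<phi> u\<close> up to a small error, and both are close to
  \<open>q * L\<close> for small \<open>u\<close>.\<close>

theorem zero_count_asymptotics: "((\<lambda>R. real (zero_count f R) / R ^ q) \<longlongrightarrow> real q * L) at_top"
proof (rule tendstoI)
  fix e :: real assume e: "e > 0"
  obtain z0 where z0: "f z0 \<noteq> 0" using not_identically_zero by blast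
  define \<phi> where "\<phi> u = L * ((exp (real q * u) - 1) / u)" for u :: real
  have "((\<lambda>u. exp (real q * u)) has_real_derivative real q) (at 0)"
    by (auto intro!: derivative_eq_intros)
  then have "((\<lambda>u. (exp (real q * u) - 1) / u) \<longlongrightarrow> real q) (at 0)"
    by (simp add: has_field_derivative_iff)
  then have "(\<phi> \<longlongrightarrow> L * real q) (at 0)" unfolding \<phi>_def by (intro tendsto_intros)
  then have "\<forall>\<^sub>F u in at 0. dist (\<phi> u) (L * real q) < e / 4" using e by (intro tendstoD) auto
  then obtain d where d: "d > 0" "\<And>u. u \<noteq> 0 \<Longrightarrow> \<bar>u\<bar> < d \<Longrightarrow> \<bar>\<phi> u - L * real q\<bar> < e / 4"
    by (auto simp: eventually_at dist_real_def)
  define u where "u = d / 2"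
  have u: "u > 0" "\<bar>\<phi> u - L * real q\<bar> < e / 4" "\<bar>\<phi> (- u) - L * real q\<bar> < e / 4"
    using d by (auto simp: u_def)
  have \<phi>_mult: "u * \<phi> u = L * (exp (real q * u) - 1)" "u * \<phi> (- u) = L * (1 - exp (- (real q * u)))"
    using u(1) by (simp_all add: \<phi>_def field_simps)
  \<comment> \<open>The relative error \<open>\<delta>\<close> enters at both radii; for
    \<open>R\<close> and \<open>exp u * R\<close> this choice makes the total exactly
    \<open>e / 4\<close> after division by \<open>u * R ^ q\<close>, and for
    \<open>exp (- u) * R\<close> and \<open>R\<close> at most that.\<close>
  define \<delta> where "\<delta> = e / 4 * u / (exp (real q * u) + 1)"
  have pos: "exp (real q * u) + 1 > 0" by (simp add: add_pos_pos)
  have \<delta>: "\<delta> > 0" unfolding \<delta>_def using e u(1) pos by (intro divide_pos_pos mult_pos_pos) auto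
  have \<delta>_eq: "\<delta> * (exp (real q * u) + 1) = e / 4 * u"
    by (rule nonzero_eq_divide_eq[THEN iffD1, OF _ \<delta>_def]) (use pos in linarith)
  have "exp (- (real q * u)) \<le> exp (real q * u)" using u by simp
  then have \<delta>': "\<delta> * (exp (- (real q * u)) + 1) \<le> e / 4 * u"
    unfolding \<delta>_eq[symmetric] using \<delta> by (intro mult_left_mono) auto
  obtain R0 where R0: "R0 > 0" "\<And>R. R \<ge> R0 \<Longrightarrow> (L - \<delta>) * R ^ q \<le> jensen f R"
    "\<And>R. R \<ge> R0 \<Longrightarrow> jensen f R \<le> (L + \<delta>) * R ^ q"
    using jensen_asymptotics[OF \<delta>] by blast
  show "\<forall>\<^sub>F R in at_top. dist (real (zero_count f R) / R ^ q) (real q * L) < e"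
    using eventually_ge_at_top[of "R0 * exp u"]
  proof eventually_elim
    case (elim R)
    have "R0 * 1 \<le> R0 * exp u" using R0 u by (intro mult_left_mono) auto
    then have R: "R \<ge> R0" "R > 0" using elim R0(1) by linarith+
    have Rm: "R0 \<le> exp (- u) * R" using elim by (simp add: exp_minus field_simps)
    have Rp: "R \<le> exp u * R" using u R by simp
    define n where "n = real (zero_count f R)"
    have "n * (ln (exp u * R) - ln R) \<le> jensen f (exp u * R) - jensen f R"
      unfolding n_def by (rule zero_count_jensen_bounds(1)[OF holo z0 R(2) Rp])
    also have "\<dots> \<le> (L + \<delta>) * (exp u * R) ^ q - (L - \<delta>) * R ^ q"
      using R0(2)[of R] R0(3)[of "exp u * R"] R Rp by linarith
    also have "\<dots> = R ^ q * (L * (exp (real q * u) - 1) + \<delta> * (exp (real q * u) + 1))"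
      by (simp add: power_mult_distrib exp_of_nat_mult[symmetric] algebra_simps)
    also have "\<dots> = R ^ q * u * (\<phi> u + e / 4)"
      unfolding \<delta>_eq \<phi>_mult[symmetric] by (simp add: algebra_simps)
    also have "ln (exp u * R) - ln R = u" using R by (simp add: ln_mult)
    finally have "n * u \<le> (R ^ q * (\<phi> u + e / 4)) * u" by (simp add: mult_ac)
    then have "n / R ^ q \<le> \<phi> u + e / 4" using u(1) R by (simp add: pos_divide_le_eq mult.commute)
    then have hi: "n / R ^ q < real q * L + e"
      using u(2) e abs_ge_self[of "\<phi> u - L * real q"] by (simp only: mult.commute[of L])
    have Rm': "0 < exp (- u) * R" "exp (- u) * R \<le> R" using u R by auto
    have "R ^ q * u * (\<phi> (- u) - e / 4) = R ^ q * (L * (1 - exp (- (real q * u)))) - R ^ q * (e / 4 * u)"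
      unfolding \<phi>_mult[symmetric] by (simp add: algebra_simps)
    also have "\<dots> \<le> R ^ q * (L * (1 - exp (- (real q * u)))) - R ^ q * (\<delta> * (exp (- (real q * u)) + 1))"
      using \<delta>' R by (intro diff_left_mono mult_left_mono) auto
    also have "\<dots> = (L - \<delta>) * R ^ q - (L + \<delta>) * (exp (- u) * R) ^ q"
      by (simp add: power_mult_distrib exp_of_nat_mult[symmetric] algebra_simps)
    also have "\<dots> \<le> jensen f R - jensen f (exp (- u) * R)"
      using R0(2)[of R] R0(3)[of "exp (- u) * R"] R Rm by linarith
    also have "\<dots> \<le> n * (ln R - ln (exp (- u) * R))"
      unfolding n_def by (rule zero_count_jensen_bounds(2)[OF holo z0 Rm'])
    also have "ln R - ln (exp (- u) * R) = u" using R by (simp add: ln_mult)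
    finally have "(R ^ q * (\<phi> (- u) - e / 4)) * u \<le> n * u" by (simp add: mult_ac)
    then have "\<phi> (- u) - e / 4 \<le> n / R ^ q" using u(1) R by (simp add: pos_le_divide_eq mult.commute)
    then have "real q * L - e < n / R ^ q"
      using u(3) e abs_ge_minus_self[of "\<phi> (- u) - L * real q"] by (simp only: mult.commute[of L])
    then show "dist (real (zero_count f R) / R ^ q) (real q * L) < e"
      using hi by (simp add: dist_real_def n_def abs_less_iff)
  qed
qed

end

section \<open>Functions of growth less than order q\<close>

text \<open>At most order \<open>q\<close>, minimal type. The bound covers whole discs, since points
  will be known only to have modulus at most a multiple of \<open>R\<close>.\<close>

definition small_growth :: "nat \<Rightarrow> (complex \<Rightarrow> complex) \<Rightarrow> bool" where
  "small_growth q H \<longleftrightarrow>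
     (\<forall>e>0. \<forall>\<^sub>F R in at_top. \<forall>z. norm z \<le> R \<longrightarrow> norm (H z) \<le> exp (e * R ^ q))"

lemma small_growthD:
  "small_growth q H \<Longrightarrow> e > 0 \<Longrightarrow> \<forall>\<^sub>F R in at_top. \<forall>z. norm z \<le> R \<longrightarrow> norm (H z) \<le> exp (e * R ^ q)"
  by (simp add: small_growth_def)

section \<open>Exponential polynomials of lower order have small growth\<close>

lemma eventually_le_exp_power:
  assumes "q \<ge> 1" "e > 0"
  shows "\<forall>\<^sub>F R::real in at_top. c \<le> exp (e * R ^ q)"
proof -
  have "filterlim (\<lambda>R::real. e * R ^ q) at_top at_top"
    using assms by (intro filterlim_tendsto_pos_mult_at_top[OF tendsto_const] filterlim_pow_at_top filterlim_ident) auto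
  then have "filterlim (\<lambda>R::real. exp (e * R ^ q)) at_top at_top"
    by (rule filterlim_compose[OF exp_at_top])
  then show ?thesis by (simp add: filterlim_at_top)
qed

lemma norm_poly_le:
  fixes p :: "complex poly"
  assumes "norm z \<le> R" "R \<ge> 1" "degree p \<le> d"
  shows "norm (poly p z) \<le> (\<Sum>i\<le>degree p. norm (coeff p i)) * R ^ d"
proof -
  have "norm (poly p z) \<le> (\<Sum>i\<le>degree p. norm (coeff p i * z ^ i))"
    unfolding poly_altdef by (rule norm_sum)
  also have "\<dots> \<le> (\<Sum>i\<le>degree p. norm (coeff p i) * R ^ d)"
  proof (rule sum_mono)
    fix i assume i: "i \<in> {..degree p}"
    have "norm z ^ i \<le> R ^ i" using assms by (intro power_mono) auto
    also have "\<dots> \<le> R ^ d" using assms i by (intro power_increasing) auto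
    finally show "norm (coeff p i * z ^ i) \<le> norm (coeff p i) * R ^ d"
      by (simp add: norm_mult norm_power mult_left_mono)
  qed
  finally show ?thesis by (simp add: sum_distrib_right)
qed

lemma small_growth_poly:
  assumes q: "q \<ge> 1"
  shows "small_growth q (poly p)"
  unfolding small_growth_def
proof (intro allI impI)
  fix e :: real assume e: "e > 0"
  define S where "S = (\<Sum>i\<le>degree p. norm (coeff p i))"
  define k where "k = degree p"
  have "S \<ge> 0" unfolding S_def by (intro sum_nonneg) auto
  have "((\<lambda>x. S / e ^ k * (x ^ k / exp x)) \<longlongrightarrow> S / e ^ k * 0) (at_top :: real filter)"
    by (intro tendsto_intros tendsto_power_div_exp_0)
  then have "\<forall>\<^sub>F x::real in at_top. S / e ^ k * (x ^ k / exp x) < 1"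
    by (intro order_tendstoD) auto
  moreover have "filterlim (\<lambda>R::real. e * R) at_top at_top"
    using e by (intro filterlim_tendsto_pos_mult_at_top[OF tendsto_const] filterlim_ident) auto
  ultimately have "\<forall>\<^sub>F R::real in at_top. S / e ^ k * ((e * R) ^ k / exp (e * R)) < 1"
    by (rule eventually_compose_filterlim)
  then show "\<forall>\<^sub>F R in at_top. \<forall>z. norm z \<le> R \<longrightarrow> norm (poly p z) \<le> exp (e * R ^ q)"
    using eventually_ge_at_top[of 1]
  proof eventually_elim
    case (elim R)
    then have "S * R ^ k \<le> exp (e * R)" using e by (simp add: power_mult_distrib field_simps)
    also have "\<dots> \<le> exp (e * R ^ q)" using elim q e by (simp add: self_le_power)
    finally show ?case using norm_poly_le[of _ R p k] elim by (auto simp: S_def k_def intro: order.trans)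
  qed
qed

lemma small_growth_exp_poly:
  assumes "degree p < q"
  shows "small_growth q (\<lambda>z. exp (poly p z))"
  unfolding small_growth_def
proof (intro allI impI)
  fix e :: real assume e: "e > 0"
  define S where "S = (\<Sum>i\<le>degree p. norm (coeff p i))"
  show "\<forall>\<^sub>F R in at_top. \<forall>z. norm z \<le> R \<longrightarrow> norm (exp (poly p z)) \<le> exp (e * R ^ q)"
    using eventually_ge_at_top[of 1] eventually_ge_at_top[of "S / e"]
  proof eventually_elim
    case (elim R)
    have "S * R ^ (q - 1) \<le> (e * R) * R ^ (q - 1)"
      using elim e by (intro mult_right_mono) (auto simp: field_simps)
    also have "\<dots> = e * R ^ q" using assms by (cases q) auto
    finally have "S * R ^ (q - 1) \<le> e * R ^ q" .
    moreover have "degree p \<le> q - 1" using assms by simp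
    ultimately have "norm (poly p z) \<le> e * R ^ q" if "norm z \<le> R" for z
      using norm_poly_le[of z R p "q - 1"] that elim(1) by (fastforce simp: S_def)
    then show ?case
      using order.trans[OF norm_exp] by (metis exp_le_cancel_iff)
  qed
qed

lemma small_growth_mult:
  assumes "small_growth q H" "small_growth q G"
  shows "small_growth q (\<lambda>z. H z * G z)"
  unfolding small_growth_def
proof (intro allI impI)
  fix e :: real assume "e > 0"
  then have e: "e / 2 > 0" by simp
  show "\<forall>\<^sub>F R in at_top. \<forall>z. norm z \<le> R \<longrightarrow> norm (H z * G z) \<le> exp (e * R ^ q)"
    using small_growthD[OF assms(1) e] small_growthD[OF assms(2) e]
  proof eventually_elim
    case (elim R)
    have "norm (H z * G z) \<le> exp (e / 2 * R ^ q) * exp (e / 2 * R ^ q)" if "norm z \<le> R" for z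
      unfolding norm_mult using elim that by (intro mult_mono) auto
    then show ?case by (simp add: exp_add[symmetric])
  qed
qed

lemma small_growth_add:
  assumes "q \<ge> 1" "small_growth q H" "small_growth q G"
  shows "small_growth q (\<lambda>z. H z + G z)"
  unfolding small_growth_def
proof (intro allI impI)
  fix e :: real assume "e > 0"
  then have e: "e / 2 > 0" by simp
  show "\<forall>\<^sub>F R in at_top. \<forall>z. norm z \<le> R \<longrightarrow> norm (H z + G z) \<le> exp (e * R ^ q)"
    using small_growthD[OF assms(2) e] small_growthD[OF assms(3) e] eventually_le_exp_power[OF assms(1) e, of 2]
  proof eventually_elim
    case (elim R)
    have "norm (H z + G z) \<le> exp (e * R ^ q)" if "norm z \<le> R" for z
    proof -
      have "norm (H z + G z) \<le> 2 * exp (e / 2 * R ^ q)"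
        using norm_triangle_ineq[of "H z" "G z"] elim(1,2) that by fastforce
      also have "\<dots> \<le> exp (e / 2 * R ^ q) * exp (e / 2 * R ^ q)"
        using elim(3) by (intro mult_right_mono) auto
      finally show ?thesis by (simp add: exp_add[symmetric])
    qed
    then show ?case by blast
  qed
qed

lemma small_growth_sum:
  assumes "q \<ge> 1" "\<And>i. i \<in> I \<Longrightarrow> small_growth q (H i)"
  shows "small_growth q (\<lambda>z. \<Sum>i\<in>I. H i z)"
  using assms(2)
proof (induction I rule: infinite_finite_induct)
  case (insert x F)
  then show ?case by (simp add: small_growth_add[OF assms(1)])
qed (simp_all add: small_growth_def)

lemma exp_poly_of_order_small_growth:
  assumes "exp_poly_of_order d H" "d < q"
  shows "small_growth q H" and "H holomorphic_on UNIV"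
proof -
  obtain n and P Q :: "nat \<Rightarrow> complex poly"
    where H: "H = (\<lambda>z. \<Sum>j\<le>n. poly (P j) z * exp (poly (Q j) z))"
      and d: "d = Max ((\<lambda>j. degree (Q j)) ` {..n})"
    using assms(1) unfolding exp_poly_of_order_def fun_eq_iff by blast
  have "degree (Q j) < q" if "j \<le> n" for j
    using that assms(2) unfolding d by (auto intro: le_less_trans[OF Max_ge])
  then show "small_growth q H"
    unfolding H using assms(2)
    by (intro small_growth_sum small_growth_mult small_growth_poly small_growth_exp_poly) auto
  show "H holomorphic_on UNIV" unfolding H by (intro holomorphic_intros)
qed

text \<open>Three circles argument: apply the maximum principle to \<open>H z / (z - b)\<^sup>k\<close> on an annulus about \<open>b\<close>.\<close>
lemma annulus_bound:
  assumes hol: "H holomorphic_on UNIV" and r: "0 < r" "r \<le> norm (z0 - b)" "norm (z0 - b) \<le> R"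
    and in_bd: "\<And>z. norm (z - b) = r \<Longrightarrow> norm (H z) \<le> m" and out_bd: "\<And>z. norm (z - b) = R \<Longrightarrow> norm (H z) \<le> M"
  shows "norm (H z0) \<le> max (m * (norm (z0 - b) / r) ^ k) (M * (norm (z0 - b) / R) ^ k)"
proof -
  define D where "D = norm (z0 - b)"
  have D: "D > 0" "R > 0" using r by (auto simp: D_def)
  define B where "B = max (m / r ^ k) (M / R ^ k)"
  define S where "S = cball b R \<inter> - ball b r"
  have Sb: "z \<noteq> b" if "z \<in> S" for z using that r by (auto simp: S_def)
  have "closed S" by (auto simp: S_def intro: closed_Int)
  have fr: "norm (z - b) = r \<or> norm (z - b) = R" if "z \<in> frontier S" for z
  proof -
    have "z \<in> frontier (cball b R) \<union> frontier (- ball b r)"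
      using that frontier_Int_subset unfolding S_def by blast
    then show ?thesis using r D by (auto simp: frontier_complement frontier_ball frontier_cball dist_norm norm_minus_commute)
  qed
  have hol': "(\<lambda>z. H z / (z - b) ^ k) holomorphic_on S"
    using Sb by (intro holomorphic_intros holomorphic_on_subset[OF hol]) auto
  have "norm (H z0 / (z0 - b) ^ k) \<le> B"
  proof (rule maximum_modulus_frontier[of "\<lambda>z. H z / (z - b) ^ k" S])
    show "(\<lambda>z. H z / (z - b) ^ k) holomorphic_on interior S"
      using hol' interior_subset by (rule holomorphic_on_subset)
    show "continuous_on (closure S) (\<lambda>z. H z / (z - b) ^ k)"
      using hol' \<open>closed S\<close> by (simp add: holomorphic_on_imp_continuous_on)
    show "bounded S" by (simp add: S_def bounded_Int)
    show "z0 \<in> S" using r by (simp add: S_def dist_norm norm_minus_commute)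
    fix z assume "z \<in> frontier S"
    then consider "norm (z - b) = r" | "norm (z - b) = R" using fr by blast
    then show "norm (H z / (z - b) ^ k) \<le> B"
    proof cases
      case 1
      then have "norm (H z / (z - b) ^ k) \<le> m / r ^ k"
        using in_bd[OF 1] r(1) by (simp add: norm_divide norm_power divide_right_mono)
      then show ?thesis by (simp add: B_def)
    next
      case 2
      then have "norm (H z / (z - b) ^ k) \<le> M / R ^ k"
        using out_bd[OF 2] D by (simp add: norm_divide norm_power divide_right_mono)
      then show ?thesis by (simp add: B_def)
    qed
  qed
  then have "norm (H z0) \<le> B * D ^ k"
    using D by (simp add: norm_divide norm_power pos_divide_le_eq D_def)
  also have "\<dots> = max (m * (D / r) ^ k) (M * (D / R) ^ k)"
    using D by (simp add: B_def max_mult_distrib_right power_divide)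
  finally show ?thesis by (simp add: D_def)
qed

section \<open>Functions of small growth are not tiny on whole discs\<close>

lemma eventually_at_top_scale:
  assumes "\<forall>\<^sub>F R in at_top. P R" "a > 0"
  shows "\<forall>\<^sub>F R::real in at_top. P (a * R)"
proof -
  have "filterlim (\<lambda>R::real. a * R) at_top at_top"
    using assms(2) by (intro filterlim_tendsto_pos_mult_at_top[OF tendsto_const] filterlim_ident) auto
  then show ?thesis using assms(1) by (rule eventually_compose_filterlim[rotated])
qed

text \<open>If \<open>norm (H z)\<close> were below \<open>exp (- e * R ^ q)\<close> on the disc
  about \<open>R * \<zeta>\<close>, then \<open>annulus_bound\<close> with an exponent
  \<open>k\<close> proportional to \<open>R ^ q\<close> would contradict the fixed value
  \<open>norm (H z0)\<close>: in the inner term \<open>C ^ k\<close> offsets only half of the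
  exponent, and in the outer term the gain \<open>2 ^ k\<close> beats the growth of
  \<open>H\<close>.\<close>

lemma small_growth_lower_bound:
  assumes hol: "H holomorphic_on UNIV" and gr: "small_growth q H" and nz: "H z0 \<noteq> 0" and q: "q \<ge> 1"
    and e: "e > 0" and t: "t > 0"
  shows "\<forall>\<^sub>F R in at_top. \<exists>z. norm (z - of_real R * \<zeta>) < t * R \<and> exp (- e * R ^ q) \<le> norm (H z)"
proof -
  define c where "c = norm (H z0)"
  have c: "c > 0" using nz by (simp add: c_def)
  \<comment> \<open>For \<open>R \<ge> norm z0\<close> the distance of \<open>z0\<close> from the
    centre is at most \<open>l * R / 2\<close>, half the outer radius.\<close>
  define l where "l = 2 * (norm \<zeta> + 1)"
  have l: "l > 0" by (simp add: l_def add_nonneg_pos)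
  \<comment> \<open>\<open>C\<close> bounds the ratio of the distance of \<open>z0\<close> to the
    inner radius; \<open>\<kappa>\<close> makes \<open>C\<close> to the power
    \<open>\<kappa> * R ^ q\<close> at most \<open>exp (e / 2 * R ^ q)\<close>. The
    \<open>+ 1\<close> in its denominator covers \<open>C = 1\<close>.\<close>
  define C where "C = max (l / t) 1"
  define \<kappa> where "\<kappa> = e / 2 / (ln C + 1)"
  have C: "C \<ge> 1" "ln C \<ge> 0" by (auto simp: C_def)
  have \<kappa>: "\<kappa> > 0" unfolding \<kappa>_def using e C by (intro divide_pos_pos add_nonneg_pos) auto
  have \<kappa>C: "\<kappa> * ln C \<le> e / 2"
  proof -
    have "\<kappa> * ln C \<le> \<kappa> * (ln C + 1)" using \<kappa> by simp
    also have "\<dots> = e / 2"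
      by (rule nonzero_eq_divide_eq[THEN iffD1, OF _ \<kappa>_def]) (use C in linarith)
    finally show ?thesis .
  qed
  \<comment> \<open>The outer circle lies in the disc of radius \<open>a * R\<close>, and
    \<open>e1\<close> allows \<open>H\<close> there only half of the exponent
    \<open>\<kappa> * ln 2 * R ^ q\<close> gained from \<open>2 ^ k\<close>.\<close>
  define a where "a = norm \<zeta> + l"
  have a: "a > 0" using l by (simp add: a_def add_nonneg_pos)
  define e1 where "e1 = \<kappa> * ln 2 / 2 / a ^ q"
  have e1: "e1 > 0" using \<kappa> a by (simp add: e1_def)
  have e2: "e / 2 > 0" "\<kappa> * ln 2 / 2 > 0" using e \<kappa> by auto
  show ?thesis
    using eventually_at_top_scale[OF small_growthD[OF gr e1] a]
      eventually_le_exp_power[OF q e2(1), of "2 / c"] eventually_le_exp_power[OF q e2(2), of "4 / c"]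
      eventually_ge_at_top[of "norm z0"] eventually_gt_at_top[of 0]
  proof eventually_elim
    case (elim R)
    note R = elim(5)
    define b where "b = of_real R * \<zeta>"
    define \<delta> where "\<delta> = exp (- e * R ^ q)"
    have X: "R ^ q > 0" using R by simp
    have nb: "norm b = R * norm \<zeta>" using R by (simp add: b_def norm_mult)
    show ?case
    proof (rule ccontr)
      assume "\<not> ?case"
      then have small: "norm (H z) < \<delta>" if "norm (z - b) < t * R" for z
        using that by (auto simp: b_def \<delta>_def not_le)
      have half: "exp (- (e / 2 * R ^ q)) \<le> c / 2"
        using elim(2) c by (simp add: exp_minus field_simps)
      have \<delta>_le: "\<delta> \<le> exp (- (e / 2 * R ^ q))" using e X by (simp add: \<delta>_def)
      have D: "norm (z0 - b) \<le> l * R / 2"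
        using norm_triangle_ineq4[of z0 b] elim(4) nb by (simp add: l_def algebra_simps)
      have ge: "t * R / 2 \<le> norm (z0 - b)"
      proof (rule ccontr)
        assume "\<not> ?thesis"
        moreover have "0 < t * R" using t R by simp
        ultimately have "c < \<delta>" unfolding c_def by (intro small) linarith
        then show False using \<delta>_le half c by linarith
      qed
      \<comment> \<open>Rounding down costs at most one factor \<open>2\<close>, which the estimate
        with \<open>4 / c\<close> absorbs.\<close>
      define k where "k = nat \<lfloor>\<kappa> * R ^ q\<rfloor>"
      have k: "real k \<le> \<kappa> * R ^ q" "\<kappa> * R ^ q - 1 \<le> real k"
        using \<kappa> X by (auto simp: k_def)
      have "c \<le> max (\<delta> * (norm (z0 - b) / (t * R / 2)) ^ k)
        (exp (e1 * (a * R) ^ q) * (norm (z0 - b) / (l * R)) ^ k)"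
        unfolding c_def
      proof (rule annulus_bound[OF hol _ ge])
        show "0 < t * R / 2" "norm (z0 - b) \<le> l * R" using D mult_pos_pos[OF l R] mult_pos_pos[OF t R] by auto
        show "norm (H z) \<le> \<delta>" if "norm (z - b) = t * R / 2" for z
          using small[of z] that t R by (simp add: less_imp_le)
        show "norm (H z) \<le> exp (e1 * (a * R) ^ q)" if "norm (z - b) = l * R" for z
        proof -
          have "norm z \<le> a * R" using norm_triangle_sub[of z b] that nb by (simp add: a_def algebra_simps)
          then show ?thesis using elim(1) by blast
        qed
      qed
      moreover have "\<delta> * (norm (z0 - b) / (t * R / 2)) ^ k < c"
      proof -
        have "norm (z0 - b) / (t * R / 2) \<le> l / t" using D t R by (simp add: field_simps)
        also have "\<dots> \<le> C" by (simp add: C_def)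
        finally have "(norm (z0 - b) / (t * R / 2)) ^ k \<le> C ^ k"
          using t R by (intro power_mono) auto
        also have "C ^ k = exp (real k * ln C)" using C by (simp add: exp_of_nat_mult)
        also have "real k * ln C \<le> \<kappa> * R ^ q * ln C" using k C by (intro mult_right_mono)
        also have "\<dots> \<le> e / 2 * R ^ q" using mult_right_mono[OF \<kappa>C, of "R ^ q"] X by (simp add: mult_ac)
        finally have "\<delta> * (norm (z0 - b) / (t * R / 2)) ^ k \<le> \<delta> * exp (e / 2 * R ^ q)"
          by (simp add: \<delta>_def)
        also have "\<dots> = exp (- (e / 2 * R ^ q))" by (simp add: \<delta>_def exp_add[symmetric])
        finally show ?thesis using half c by linarith
      qed
      moreover have "exp (e1 * (a * R) ^ q) * (norm (z0 - b) / (l * R)) ^ k < c"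
      proof -
        have "norm (z0 - b) / (l * R) \<le> 1 / 2" using D l R by (simp add: field_simps)
        then have "(norm (z0 - b) / (l * R)) ^ k \<le> (1 / 2) ^ k"
          using l R by (intro power_mono) auto
        also have "\<dots> = exp (- (real k * ln 2))"
          by (simp add: exp_minus exp_of_nat_mult power_one_over inverse_eq_divide)
        also have "\<dots> \<le> exp (- ((\<kappa> * R ^ q - 1) * ln 2))"
          using k(2) by simp
        finally have "exp (e1 * (a * R) ^ q) * (norm (z0 - b) / (l * R)) ^ k \<le>
            exp (e1 * (a * R) ^ q) * exp (- ((\<kappa> * R ^ q - 1) * ln 2))" by simp
        also have "\<dots> = exp (e1 * (a * R) ^ q - (\<kappa> * R ^ q - 1) * ln 2)"
          by (simp add: exp_add[symmetric])
        also have e1_eq: "e1 * (a * R) ^ q = \<kappa> * ln 2 / 2 * R ^ q"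
          using a by (simp add: e1_def power_mult_distrib)
        also have "\<kappa> * ln 2 / 2 * R ^ q - (\<kappa> * R ^ q - 1) * ln 2 = ln 2 + - (\<kappa> * ln 2 / 2 * R ^ q)"
          by (simp add: field_simps)
        also have "exp \<dots> = 2 * exp (- (\<kappa> * ln 2 / 2 * R ^ q))" unfolding exp_add by simp
        also have "\<dots> \<le> c / 2" using elim(3) c by (simp add: exp_minus field_simps)
        finally show ?thesis unfolding e1_eq using c by simp
      qed
      ultimately show False by simp
    qed
  qed
qed

section \<open>Exponential sums\<close>

lemma continuous_on_Max_image:
  fixes g :: "'i \<Rightarrow> 'a::topological_space \<Rightarrow> real"
  assumes "finite I" "I \<noteq> {}" "\<And>i. i \<in> I \<Longrightarrow> continuous_on S (g i)"
  shows "continuous_on S (\<lambda>x. Max ((\<lambda>i. g i x) ` I))"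
  using assms
proof (induction I rule: finite_ne_induct)
  case (insert x F)
  then show ?case by (simp add: continuous_on_max)
qed simp

text \<open>The coefficients enter only through being entire, of small growth and not identically
  zero. The last condition makes every \<open>w j\<close> count in the hull.\<close>

locale exp_sum =
  fixes q :: nat and J :: "nat set" and w :: "nat \<Rightarrow> complex" and H :: "nat \<Rightarrow> complex \<Rightarrow> complex"
  assumes q: "q \<ge> 1" and fin: "finite J" and ne: "J \<noteq> {}" and inj: "inj_on w J"
    and hol: "\<And>j. j \<in> J \<Longrightarrow> H j holomorphic_on UNIV"
    and growth: "\<And>j. j \<in> J \<Longrightarrow> small_growth q (H j)"
    and nonzero: "\<And>j. j \<in> J \<Longrightarrow> \<exists>z. H j z \<noteq> 0"
begin

definition f :: "complex \<Rightarrow> complex" where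
  "f z = (\<Sum>j\<in>J. H j z * exp (w j * z ^ q))"

definition growth_rate :: "complex \<Rightarrow> real" where
  "growth_rate z = Max ((\<lambda>j. Re (w j * z ^ q)) ` J)"

text \<open>Conjugates appear because \<open>Re (a * b)\<close> is the real inner product of
  \<open>cnj a\<close> and \<open>b\<close>; this makes \<open>growth_rate (cis t)\<close> the
  support function of the set at the angle \<open>q * t\<close>.\<close>

definition frequencies :: "complex set" where
  "frequencies = (\<lambda>j. cnj (w j)) ` J"

lemma growth_rate_ge: "j \<in> J \<Longrightarrow> Re (w j * z ^ q) \<le> growth_rate z"
  unfolding growth_rate_def using fin by auto

lemma growth_rate_attained: "\<exists>j\<in>J. Re (w j * z ^ q) = growth_rate z"
  using Max_in[of "(\<lambda>j. Re (w j * z ^ q)) ` J"] fin ne unfolding growth_rate_def by fastforce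

lemma growth_rate_eqI:
  "j \<in> J \<Longrightarrow> (\<And>k. k \<in> J \<Longrightarrow> Re (w k * z ^ q) \<le> Re (w j * z ^ q)) \<Longrightarrow> growth_rate z = Re (w j * z ^ q)"
  unfolding growth_rate_def using fin by (intro Max_eqI) auto

lemma continuous_growth_rate: "continuous_on S growth_rate"
  unfolding growth_rate_def[abs_def] by (intro continuous_on_Max_image fin ne continuous_intros)

lemma Re_scale: "Re (a * (of_real R * z) ^ q) = R ^ q * Re (a * z ^ q)"
proof -
  have "a * (of_real R * z) ^ q = of_real (R ^ q) * (a * z ^ q)" by (simp add: power_mult_distrib)
  then show ?thesis by (simp only: Re_complex_of_real times_complex.sel Im_complex_of_real mult_zero_left diff_zero)
qed

lemma growth_rate_scale:
  assumes "R > 0"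
  shows "growth_rate (of_real R * z) = R ^ q * growth_rate z"
proof -
  obtain j where j: "j \<in> J" "Re (w j * z ^ q) = growth_rate z" using growth_rate_attained by blast
  have "growth_rate (of_real R * z) = Re (w j * (of_real R * z) ^ q)"
  proof (rule growth_rate_eqI[OF j(1)])
    show "Re (w k * (of_real R * z) ^ q) \<le> Re (w j * (of_real R * z) ^ q)" if "k \<in> J" for k
      unfolding Re_scale j(2) using growth_rate_ge[OF that, of z] assms by (intro mult_left_mono) auto
  qed
  also have "\<dots> = R ^ q * growth_rate z" unfolding Re_scale j(2) ..
  finally show ?thesis .
qed

lemma finite_frequencies: "finite frequencies" and frequencies_nonempty: "frequencies \<noteq> {}"
  using fin ne by (auto simp: frequencies_def)

lemma growth_rate_cis: "growth_rate (cis t) = support frequencies (real q * t)"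
proof -
  have "Re (a * cis t ^ q) = cnj a \<bullet> cis (real q * t)" for a
  proof -
    have "Re (a * b) = cnj a \<bullet> b" for b by (simp add: inner_complex_def)
    then show ?thesis by (simp only: Complex.DeMoivre)
  qed
  then show ?thesis by (simp only: growth_rate_def support_def frequencies_def image_image)
qed

section \<open>Bounds for the sum by its indicator\<close>

lemma holomorphic_f: "f holomorphic_on UNIV"
  unfolding f_def[abs_def] by (intro holomorphic_intros hol)

lemma upper_bound:
  assumes "e > 0"
  shows "\<forall>\<^sub>F R in at_top. \<forall>z. norm z = R \<longrightarrow> norm (f z) \<le> exp (growth_rate z + e * R ^ q)"
proof -
  have e: "e / 2 > 0" using assms by simp
  have "\<forall>\<^sub>F R in at_top. \<forall>j\<in>J. \<forall>z. norm z \<le> R \<longrightarrow> norm (H j z) \<le> exp (e / 2 * R ^ q)"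
    unfolding eventually_ball_finite_distrib[OF fin] using small_growthD[OF growth e] by blast
  then show ?thesis using eventually_le_exp_power[OF q e, of "real (card J)"]
  proof eventually_elim
    case (elim R)
    have "norm (f z) \<le> exp (growth_rate z + e * R ^ q)" if z: "norm z = R" for z
    proof -
      have "norm (f z) \<le> (\<Sum>j\<in>J. norm (H j z * exp (w j * z ^ q)))" unfolding f_def by (rule norm_sum)
      also have "\<dots> \<le> (\<Sum>j\<in>J. exp (e / 2 * R ^ q) * exp (growth_rate z))"
        unfolding norm_mult norm_exp_eq_Re using elim(1) z growth_rate_ge
        by (intro sum_mono mult_mono) auto
      also have "\<dots> = real (card J) * (exp (e / 2 * R ^ q) * exp (growth_rate z))" by simp
      also have "\<dots> \<le> exp (e / 2 * R ^ q) * (exp (e / 2 * R ^ q) * exp (growth_rate z))"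
        using elim(2) by (intro mult_right_mono) auto
      also have "\<dots> = exp (growth_rate z + e * R ^ q)" by (simp add: exp_add[symmetric])
      finally show ?thesis .
    qed
    then show ?case by blast
  qed
qed

text \<open>A slight rotation of \<open>\<zeta>\<close> reaches a point whose \<open>q\<close>-fold
  angle is not critical, since critical angles are finite in number on bounded intervals. There no
  two exponentials have the same size, so one dominates strictly.\<close>

lemma noncritical_point_nearby:
  assumes "\<zeta> \<noteq> 0" and U: "open U" "\<zeta> \<in> U"
  obtains \<xi> j where "\<xi> \<in> U" "j \<in> J" "\<And>k. k \<in> J \<Longrightarrow> k \<noteq> j \<Longrightarrow> Re (w k * \<xi> ^ q) < Re (w j * \<xi> ^ q)"
proof -
  define \<rho> where "\<rho> = norm \<zeta>"
  define t0 where "t0 = Arg \<zeta>"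
  define g where "g t = of_real \<rho> * cis t" for t
  have \<rho>: "\<rho> > 0" using assms by (simp add: \<rho>_def)
  have g0: "g t0 = \<zeta>" unfolding g_def \<rho>_def t0_def using rcis_cmod_Arg[of \<zeta>] by (simp add: rcis_def)
  have "isCont g t0" unfolding g_def[abs_def]
    by (intro continuous_intros continuous_on_interior[of UNIV]) auto
  then have "\<forall>\<^sub>F t in at t0. g t \<in> U"
    using U g0 by (metis isCont_def topological_tendstoD)
  then obtain d where d: "d > 0" "\<And>t. t \<noteq> t0 \<Longrightarrow> \<bar>t - t0\<bar> < d \<Longrightarrow> g t \<in> U"
    by (auto simp: eventually_at dist_real_def)
  have "finite (critical frequencies \<inter> {real q * t0..real q * (t0 + d)})"
    by (rule finite_critical[OF finite_frequencies])
  moreover have "infinite {real q * t0<..<real q * (t0 + d)}"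
    using q d by (intro infinite_Ioo) auto
  ultimately obtain s where s: "s \<in> {real q * t0<..<real q * (t0 + d)}" "s \<notin> critical frequencies"
  proof -
    have "\<not> {real q * t0<..<real q * (t0 + d)} \<subseteq> critical frequencies \<inter> {real q * t0..real q * (t0 + d)}"
      using \<open>infinite {real q * t0<..<real q * (t0 + d)}\<close>
        \<open>finite (critical frequencies \<inter> {real q * t0..real q * (t0 + d)})\<close> finite_subset by blast
    then obtain s where "s \<in> {real q * t0<..<real q * (t0 + d)}"
      "s \<notin> critical frequencies \<inter> {real q * t0..real q * (t0 + d)}" by blast
    then show ?thesis using that[of s] by auto
  qed
  define t where "t = s / real q"
  have qt: "real q * t = s" using q by (simp add: t_def)
  then have "real q * t0 < real q * t" "real q * t < real q * (t0 + d)" using s by auto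
  then have t: "t0 < t" "t < t0 + d" using q by simp_all
  obtain j where j: "j \<in> J" "Re (w j * g t ^ q) = growth_rate (g t)" using growth_rate_attained by blast
  show ?thesis
  proof (rule that[of "g t" j])
    show "g t \<in> U" using t d by auto
    show "j \<in> J" by fact
    fix k assume k: "k \<in> J" "k \<noteq> j"
    have Re_g: "Re (a * g t ^ q) = \<rho> ^ q * (cnj a \<bullet> cis s)" for a
      unfolding g_def Re_scale by (simp add: Complex.DeMoivre qt inner_complex_def)
    have "cnj (w k) \<noteq> cnj (w j)" using inj j k by (auto simp: inj_on_def)
    then have "(cnj (w k) - cnj (w j)) \<bullet> cis s \<noteq> 0"
      using s(2) j(1) k(1) unfolding critical_def frequencies_def by blast
    then have "Re (w k * g t ^ q) \<noteq> Re (w j * g t ^ q)"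
      using \<rho> unfolding Re_g by (simp add: inner_diff_left)
    then show "Re (w k * g t ^ q) < Re (w j * g t ^ q)" using growth_rate_ge[OF k(1), of "g t"] j(2) by simp
  qed
qed

text \<open>Near \<open>\<zeta>\<close> there is a point \<open>\<xi>\<close> with a dominant term
  \<open>j\<close>, and the domination persists around it with a fixed gap. After scaling by
  \<open>R\<close>, \<open>small_growth_lower_bound\<close> finds a point where \<open>H j\<close>
  is not tiny; there the other terms together are at most half of the lower bound for this
  one.\<close>

lemma lower_bound:
  assumes e: "e > 0" and s: "s > 0" and \<zeta>: "\<zeta> \<noteq> 0"
  shows "\<forall>\<^sub>F R in at_top. \<exists>z. norm (z - of_real R * \<zeta>) < s * R \<and>
    exp ((growth_rate \<zeta> - e) * R ^ q) \<le> norm (f z)"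
proof -
  have "open (ball \<zeta> (s / 2) \<inter> {z. growth_rate \<zeta> - e / 2 < growth_rate z})"
    by (intro open_Int open_ball open_Collect_less continuous_on_const continuous_growth_rate)
  moreover have "\<zeta> \<in> ball \<zeta> (s / 2) \<inter> {z. growth_rate \<zeta> - e / 2 < growth_rate z}" using e s by simp
  ultimately obtain \<xi> j where \<xi>: "\<xi> \<in> ball \<zeta> (s / 2) \<inter> {z. growth_rate \<zeta> - e / 2 < growth_rate z}"
    and j: "j \<in> J" and dom: "\<And>k. k \<in> J \<Longrightarrow> k \<noteq> j \<Longrightarrow> Re (w k * \<xi> ^ q) < Re (w j * \<xi> ^ q)"
    by (rule noncritical_point_nearby[OF \<zeta>]) blast
  have ind: "growth_rate \<xi> = Re (w j * \<xi> ^ q)"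
    using dom by (intro growth_rate_eqI j) (metis order.refl less_imp_le)
  obtain \<kappa> where \<kappa>: "\<kappa> > 0" "\<And>k. k \<in> J \<Longrightarrow> k \<noteq> j \<Longrightarrow> \<kappa> < Re (w j * \<xi> ^ q) - Re (w k * \<xi> ^ q)"
  proof -
    have "\<exists>\<kappa>>0. \<forall>k\<in>J - {j}. \<kappa> < Re (w j * \<xi> ^ q) - Re (w k * \<xi> ^ q)"
    proof -
      have "\<forall>\<^sub>F \<kappa> in at_right 0. \<forall>k\<in>J - {j}. \<kappa> < Re (w j * \<xi> ^ q) - Re (w k * \<xi> ^ q)"
        using fin dom by (subst eventually_ball_finite_distrib) (auto intro!: order_tendstoD tendsto_ident_at)
      then have "\<forall>\<^sub>F \<kappa> in at_right (0::real). \<kappa> > 0 \<and> (\<forall>k\<in>J - {j}. \<kappa> < Re (w j * \<xi> ^ q) - Re (w k * \<xi> ^ q))"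
        using eventually_at_right_less[of 0] by eventually_elim auto
      then show ?thesis using eventually_happens'[of "at_right (0::real)"] by auto
    qed
    then show ?thesis using that by auto
  qed
  \<comment> \<open>The open set where the gap \<open>\<kappa>\<close> persists and the dominant
    exponent stays above \<open>growth_rate \<zeta> - e / 2\<close>.\<close>
  define W where "W = (\<Inter>k\<in>J - {j}. {z. \<kappa> < Re (w j * z ^ q) - Re (w k * z ^ q)}) \<inter>
    {z. growth_rate \<zeta> - e / 2 < Re (w j * z ^ q)}"
  have "open W" unfolding W_def
    using fin by (intro open_Int open_INT open_Collect_less ballI) (auto intro!: continuous_intros)
  moreover have "\<xi> \<in> W" using \<kappa> \<xi> ind by (auto simp: W_def)
  ultimately obtain t0 where t0: "t0 > 0" "ball \<xi> t0 \<subseteq> W" using open_contains_ball by blast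
  define t where "t = min t0 (s / 2)"
  have t: "t > 0" "t \<le> s / 2" "ball \<xi> t \<subseteq> W" using t0 s by (auto simp: t_def)
  \<comment> \<open>Budget: \<open>e0\<close> for the other coefficients and \<open>e0\<close> for
    the possible smallness of \<open>H j\<close> leave a gap of at least
    \<open>\<kappa> / 2\<close>. In the final estimate, \<open>e0\<close> for \<open>H j\<close> and
    \<open>e0\<close> for the factor \<open>1 / 2\<close> fit into the remaining
    \<open>e / 2\<close>.\<close>
  define e0 where "e0 = min (\<kappa> / 4) (e / 4)"
  have e0: "e0 > 0" "\<kappa> - 2 * e0 \<ge> \<kappa> / 2" "2 * e0 \<le> e / 2" using \<kappa> e by (auto simp: e0_def min_def)
  define a where "a = norm \<xi> + t"
  have a: "a > 0" using t by (simp add: a_def add_nonneg_pos)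
  \<comment> \<open>With this the growth bound at radius \<open>a * R\<close>, which covers the
    points used, reads \<open>exp (e0 * R ^ q)\<close>.\<close>
  define e1 where "e1 = e0 / a ^ q"
  have e1: "e1 > 0" using e0 a by (simp add: e1_def)
  obtain z0 where z0: "H j z0 \<noteq> 0" using nonzero[OF j] by blast
  have "\<forall>\<^sub>F R in at_top. \<forall>k\<in>J. \<forall>z. norm z \<le> R \<longrightarrow> norm (H k z) \<le> exp (e1 * R ^ q)"
    unfolding eventually_ball_finite_distrib[OF fin] using small_growthD[OF growth e1] by blast
  from eventually_at_top_scale[OF this a] show ?thesis
    using small_growth_lower_bound[OF hol[OF j] growth[OF j] z0 q e0(1) t(1), of \<xi>]
      eventually_le_exp_power[OF q half_gt_zero[OF \<kappa>(1)], of "2 * real (card J)"]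
      eventually_le_exp_power[OF q e0(1), of 2] eventually_gt_at_top[of 0]
  proof eventually_elim
    case (elim R)
    note R = elim(5)
    define X where "X = R ^ q"
    have X: "X > 0" using R by (simp add: X_def)
    obtain z where z: "norm (z - of_real R * \<xi>) < t * R" "exp (- e0 * R ^ q) \<le> norm (H j z)"
      using elim(2) by blast
    define y where "y = z / of_real R"
    have zy: "z = of_real R * y" using R by (simp add: y_def)
    have "norm (z - of_real R * \<xi>) = R * norm (y - \<xi>)"
      using R by (simp add: zy right_diff_distrib[symmetric] norm_mult)
    then have y\<xi>: "norm (y - \<xi>) < t" using z(1) R by (simp add: mult.commute)
    then have "y \<in> W" using t(3) by (auto simp: dist_norm norm_minus_commute)
    then have y: "growth_rate \<zeta> - e / 2 \<le> Re (w j * y ^ q)"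
      "\<And>k. k \<in> J \<Longrightarrow> k \<noteq> j \<Longrightarrow> Re (w k * y ^ q) \<le> Re (w j * y ^ q) - \<kappa>"
    proof -
      show "growth_rate \<zeta> - e / 2 \<le> Re (w j * y ^ q)" using \<open>y \<in> W\<close> by (simp add: W_def)
      fix k assume "k \<in> J" "k \<noteq> j"
      then have "\<kappa> < Re (w j * y ^ q) - Re (w k * y ^ q)"
        using \<open>y \<in> W\<close> unfolding W_def by blast
      then show "Re (w k * y ^ q) \<le> Re (w j * y ^ q) - \<kappa>" by linarith
    qed
    have "norm y \<le> a" using norm_triangle_sub[of y \<xi>] y\<xi> by (simp add: a_def)
    then have "norm z \<le> a * R" using R by (simp add: zy norm_mult mult.commute)
    moreover have "e1 * (a * R) ^ q = e0 * X" using a by (simp add: e1_def power_mult_distrib X_def)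
    ultimately have Hk: "norm (H k z) \<le> exp (e0 * X)" if "k \<in> J" for k using elim(1) that by metis
    define E where "E = exp (Re (w j * y ^ q) * X)"
    have term_norm: "norm (exp (w k * z ^ q)) = exp (Re (w k * y ^ q) * X)" for k
      unfolding zy norm_exp_eq_Re Re_scale X_def by (simp add: mult.commute)
    have "norm (\<Sum>k\<in>J - {j}. H k z * exp (w k * z ^ q)) \<le> (\<Sum>k\<in>J - {j}. norm (H k z * exp (w k * z ^ q)))"
      by (rule norm_sum)
    also have "\<dots> \<le> (\<Sum>k\<in>J - {j}. exp (e0 * X) * exp ((Re (w j * y ^ q) - \<kappa>) * X))"
      unfolding norm_mult term_norm using Hk y(2) X by (intro sum_mono mult_mono) auto
    also have "\<dots> = real (card (J - {j})) * (exp (e0 * X) * exp ((Re (w j * y ^ q) - \<kappa>) * X))" by simp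
    also have "\<dots> \<le> real (card J) * (exp (e0 * X) * exp ((Re (w j * y ^ q) - \<kappa>) * X))"
      using fin by (intro mult_right_mono) (auto intro: card_mono)
    also have "exp (e0 * X) * exp ((Re (w j * y ^ q) - \<kappa>) * X) = E * exp (- (\<kappa> - 2 * e0) * X) * exp (- e0 * X)"
      by (simp add: E_def exp_add[symmetric] algebra_simps)
    also have "real (card J) * \<dots> = real (card J) * exp (- (\<kappa> - 2 * e0) * X) * (E * exp (- e0 * X))"
      by (simp add: mult_ac)
    also have "\<dots> \<le> 1 / 2 * (E * exp (- e0 * X))"
    proof (rule mult_right_mono)
      define Y where "Y = (\<kappa> - 2 * e0) * X"
      have "\<kappa> / 2 * X \<le> Y" unfolding Y_def using e0(2) X by (intro mult_right_mono) auto
      then have "exp (\<kappa> / 2 * X) \<le> exp Y" by simp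
      then have "2 * real (card J) \<le> exp Y" using elim(3) unfolding X_def by linarith
      then have "real (card J) * exp (- Y) \<le> 1 / 2" by (simp add: exp_minus field_simps)
      then show "real (card J) * exp (- (\<kappa> - 2 * e0) * X) \<le> 1 / 2"
        by (simp only: Y_def mult_minus_left)
    qed (simp add: E_def)
    finally have rest: "norm (\<Sum>k\<in>J - {j}. H k z * exp (w k * z ^ q)) \<le> 1 / 2 * (E * exp (- e0 * X))" .
    have main: "E * exp (- e0 * X) \<le> norm (H j z * exp (w j * z ^ q))"
      using z(2) unfolding norm_mult term_norm X_def[symmetric] by (simp add: E_def mult.commute)
    have "f z = H j z * exp (w j * z ^ q) + (\<Sum>k\<in>J - {j}. H k z * exp (w k * z ^ q))"
      unfolding f_def by (rule sum.remove[OF fin j])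
    then have "norm (H j z * exp (w j * z ^ q)) - norm (\<Sum>k\<in>J - {j}. H k z * exp (w k * z ^ q)) \<le> norm (f z)"
      using norm_diff_ineq by metis
    then have "1 / 2 * (E * exp (- e0 * X)) \<le> norm (f z)" using main rest by linarith
    moreover have "exp ((growth_rate \<zeta> - e) * X) \<le> 1 / 2 * (E * exp (- e0 * X))"
    proof -
      have "(growth_rate \<zeta> - e) * X \<le> (Re (w j * y ^ q) - 2 * e0) * X"
        using y(1) e0(3) X by (intro mult_right_mono) auto
      then have "exp ((growth_rate \<zeta> - e) * X) \<le> exp ((Re (w j * y ^ q) - 2 * e0) * X)" by simp
      also have "\<dots> = E * exp (- e0 * X) * exp (- (e0 * X))"
        by (simp add: E_def exp_add[symmetric] algebra_simps)
      also have "\<dots> \<le> E * exp (- e0 * X) * (1 / 2)"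
      proof (rule mult_left_mono)
        show "exp (- (e0 * X)) \<le> 1 / 2" using elim(4) by (simp add: X_def exp_minus field_simps)
      qed (simp add: E_def)
      finally show ?thesis by simp
    qed
    ultimately have "exp ((growth_rate \<zeta> - e) * R ^ q) \<le> norm (f z)" unfolding X_def by linarith
    moreover have "norm (z - of_real R * \<zeta>) < s * R"
    proof -
      have "norm (\<xi> - \<zeta>) < s / 2" using \<xi> by (simp add: dist_norm norm_minus_commute)
      then have "norm (y - \<zeta>) < s"
        using norm_triangle_ineq[of "y - \<xi>" "\<xi> - \<zeta>"] y\<xi> t(2) by simp
      moreover have "norm (z - of_real R * \<zeta>) = R * norm (y - \<zeta>)"
        using R by (simp add: zy right_diff_distrib[symmetric] norm_mult)
      ultimately show ?thesis using R by (simp add: mult.commute)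
    qed
    ultimately show ?case by blast
  qed
qed

theorem zero_count_f:
  "((\<lambda>R. real (zero_count f R) / R ^ q) \<longlongrightarrow>
    real q * (circumference (convex hull frequencies) / (2 * pi))) at_top"
proof (rule zero_count_asymptotics[of f q growth_rate])
  show "((\<lambda>t. growth_rate (cis (2 * pi * t))) has_integral circumference (convex hull frequencies) / (2 * pi)) {0..1}"
    unfolding growth_rate_cis using finite_frequencies frequencies_nonempty q
    by (rule cauchy_circumference_formula)
qed (use holomorphic_f q continuous_growth_rate growth_rate_scale upper_bound lower_bound in auto)

end

section \<open>From the normal form to the exponential sum\<close>

theorem corollary3p3:
  fixes f :: "complex \<Rightarrow> complex" and q m :: nat
    and w :: "nat \<Rightarrow> complex" and H :: "nat \<Rightarrow> complex \<Rightarrow> complex"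
  assumes "exp_poly_of_order q f" and "q \<ge> 1"
    and "exp_poly_normal_form q f m w H"
    and "circumference (convex hull (conj_leading_coeffs m w H)) > 0"
  shows "(\<lambda>r::real. real (zero_count f r)
            - real q * circumference (convex hull (conj_leading_coeffs m w H)) * (r ^ q / (2 * pi)))
         \<in> o[at_top](\<lambda>r. r ^ q)"
proof -
  \<comment> \<open>Only the term with index \<open>0\<close> can vanish identically; dropping it
    matches the case distinction in \<open>conj_leading_coeffs\<close>.\<close>
  define J where "J = {j. j \<le> m \<and> H j \<noteq> (\<lambda>z. 0)}"
  define C where "C = circumference (convex hull (conj_leading_coeffs m w H))"
  have nf: "w 0 = 0" "inj_on w {..m}" "\<And>j. j \<in> {1..m} \<Longrightarrow> H j \<noteq> (\<lambda>z. 0)"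
    "\<And>j. j \<le> m \<Longrightarrow> \<exists>d<q. exp_poly_of_order d (H j)"
    "\<And>z. f z = (\<Sum>j\<le>m. H j z * exp (w j * z ^ q))"
    using assms(3) unfolding exp_poly_normal_form_def by auto
  have J: "J = (if H 0 = (\<lambda>z. 0) then {1..m} else insert 0 {1..m})"
  proof (intro set_eqI iffI)
    fix j assume "j \<in> J"
    then show "j \<in> (if H 0 = (\<lambda>z. 0) then {1..m} else insert 0 {1..m})"
      by (cases "j = 0") (auto simp: J_def)
  next
    fix j assume "j \<in> (if H 0 = (\<lambda>z. 0) then {1..m} else insert 0 {1..m})"
    then show "j \<in> J" using nf(3)[of j] by (auto simp: J_def split: if_splits)
  qed
  have V: "conj_leading_coeffs m w H = (\<lambda>j. cnj (w j)) ` J"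
    unfolding J conj_leading_coeffs_def using nf(1) by auto
  \<comment> \<open>Positivity of the circumference enters here: the empty set has circumference
    \<open>0\<close>.\<close>
  have "J \<noteq> {}"
  proof
    assume "J = {}"
    then have "conj_leading_coeffs m w H = {}" by (simp add: V)
    then show False using assms(4) by (simp add: circumference_def)
  qed
  interpret exp_sum q J w H
  proof
    show "finite J" by (simp add: J_def)
    show "inj_on w J" using nf(2) by (rule inj_on_subset) (auto simp: J_def)
    show "H j holomorphic_on UNIV" "small_growth q (H j)" if "j \<in> J" for j
      using that nf(4)[of j] exp_poly_of_order_small_growth by (auto simp: J_def)
    show "\<exists>z. H j z \<noteq> 0" if "j \<in> J" for j using that by (auto simp: J_def fun_eq_iff)
  qed fact+
  have "f z = exp_sum.f q J w H z" for z
    unfolding nf(5) f_def by (rule sum.mono_neutral_right) (auto simp: J_def)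
  then have "f = exp_sum.f q J w H" by blast
  moreover have "frequencies = conj_leading_coeffs m w H" by (simp add: frequencies_def V)
  ultimately have lim: "((\<lambda>R. real (zero_count f R) / R ^ q) \<longlongrightarrow> real q * (C / (2 * pi))) at_top"
    using zero_count_f by (simp add: C_def)
  show ?thesis
    unfolding C_def[symmetric]
  proof (rule smalloI_tendsto)
    have "((\<lambda>R. real (zero_count f R) / R ^ q - real q * (C / (2 * pi))) \<longlongrightarrow> 0) at_top"
      using tendsto_diff[OF lim tendsto_const[of "real q * (C / (2 * pi))"]] by simp
    moreover have "\<forall>\<^sub>F R::real in at_top. real (zero_count f R) / R ^ q - real q * (C / (2 * pi)) =
        (real (zero_count f R) - real q * C * (R ^ q / (2 * pi))) / R ^ q"
      using eventually_gt_at_top[of 0] by eventually_elim (simp add: field_simps)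
    ultimately show "((\<lambda>R. (real (zero_count f R) - real q * C * (R ^ q / (2 * pi))) / R ^ q) \<longlongrightarrow> 0) at_top"
      by (rule Lim_transform_eventually)
    show "\<forall>\<^sub>F R::real in at_top. R ^ q \<noteq> 0"
      using eventually_gt_at_top[of 0] by eventually_elim simp
  qed
qed

end
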